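(* Let $f_1,\dots,f_n:\mathbb{R}^d\to\mathbb{R}$ be convex and differentiable, with $\nabla f_i$ being $L_i$-Lipschitz in the Euclidean norm, let $L_{\max}=\max\{L_1,\dots,L_n\}>0$, let $R:\mathbb{R}^d\to\mathbb{R}$ be $\mu$-strongly convex with $\mu>0$, and let $x_*$ be the minimizer of $P=\frac1n\sum_{i=1}^n f_i+R$. Let $\widetilde x_0\in\mathbb{R}^d$, $\eta=5L_{\max}$, $m_1=\frac{\eta}{2\mu}$ (assumed to be a positive integer), $S\in\mathbb{N}$, and $\alpha=\frac14$. Then the iterates of the SADA algorithm (defined in the context) satisfy $$\mathbb{E}[P(\widetilde x_S)-P(x_* )]+\frac{3\mu}{2}\,\mathbb{E}\|\widetilde v_S-x_*\|^2\le\frac1{2^S}\Big[P(\widetilde x_0)-P(x_* )+\frac{3\mu}{2}\|\widetilde x_0-x_*\|^2\Big].$$ In addition, SADA has gradient complexity (defined in the context) $O\big((n+\frac{L_{\max}}{\mu})\log\frac1\varepsilon\big)$ for $\mathbb{E}[P(\widetilde x_S)-P(x_* )]\le\varepsilon$, and $O\big((n+\frac{L_{\max}}{\mu})\log\frac1{\mu\varepsilon}\big)$ for $\mathbb{E}\|\widetilde v_S-x_*\|^2\le\varepsilon$. That is, with $D=P(\widetilde x_0)-P(x_* )+\frac{3\mu}{2}\|\widetilde x_0-x_*\|^2$, there is a constant $C$ depending only on $D$ such that: for every $\varepsilon\in(0,\frac12]$ there is $S\ge1$ for which $\mathbb{E}[P(\widetilde x_S)-P(x_* )]\le\varepsilon$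 and the number of component gradient evaluations used in the first $S$ stages is at most $C(n+\frac{L_{\max}}{\mu})\log\frac1\varepsilon$; and for every $\varepsilon>0$ with $\mu\varepsilon\le\frac12$ there is $S\ge1$ for which $\mathbb{E}\|\widetilde v_S-x_*\|^2\le\varepsilon$ and that number is at most $C(n+\frac{L_{\max}}{\mu})\log\frac1{\mu\varepsilon}$.
   Context: All norms are Euclidean. $F=\frac1n\sum_{i=1}^n f_i$ and $P=F+R$. $R$ is $\mu$-strongly convex means $R(y)\ge R(x)+\xi^\top(y-x)+\frac{\mu}{2}\|y-x\|^2$ for all $x,y\in\mathbb{R}^d$ and all $\xi\in\partial R(x)$. SADA algorithm (case $\mu>0$) with inputs $\widetilde x_0\in\mathbb{R}^d$, $\eta>0$, $m_1$, and $\alpha$: set $\widetilde v_0=\widetilde x_0$. For stages $s=1,2,\dots$: put $x_0=\widetilde x_{s-1}$, $v_0=(1-\alpha)\widetilde v_{s-1}+\alpha\widetilde x_{s-1}$, $u_0=v_0$, $\bar g_0=0$, $\phi_i^0=x_0$ for $i=1,\dots,n$, and $m_s=m_1$. For $t=1,\dots,m_s$: draw $i_t$ uniformly from $\{1,\dots,n\}$ independently of all earlier draws (in this and previous stages), set $\phi_{i_t}^t=u_{t-1}$ and $\phi_i^t=\phi_i^{t-1}$ for $i\ne i_t$, and $$g_t=\nabla f_{i_t}(\phi_{i_t}^t)-\nabla f_{i_t}(\phi_{i_t}^{t-1})+\frac1n\sum_{i=1}^n\nabla f_i(\phi_i^{t-1}),\qquad \bar g_t=\Big(1-\frac1t\Big)\bar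 g_{t-1}+\frac1t g_t,$$ $$v_t=\operatorname*{argmin}_{x\in\mathbb{R}^d}\Big\{\langle\bar g_t,x\rangle+R(x)+\frac{\eta}{2t}\|x-v_0\|^2\Big\},\qquad x_t=\operatorname*{argmin}_{x\in\mathbb{R}^d}\Big\{\langle g_t,x\rangle+R(x)+\frac{\eta t}{2}\|x-u_{t-1}\|^2\Big\},$$ $$u_t=\Big(1-\frac1{t+1}\Big)x_t+\frac1{t+1}v_t .$$ Finally put $\widetilde x_s=x_{m_s}$ and $\widetilde v_s=v_{m_s}$. The expectation $\mathbb{E}$ is over all random draws. Gradient complexity is the order of the number of evaluations of component gradients $\nabla f_i$ needed to reach the stated accuracy; the average $\frac1n\sum_i\nabla f_i(\phi_i^{t})$ is computed once at the start of a stage ($n$ evaluations) and then updated incrementally, and each inner iteration uses $2$ evaluations, so stage $s$ costs $n+2m_s$ and $S$ stages cost $\sum_{s=1}^S(n+2m_s)$.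
   Formalization: R is additionally assumed to be convex, since the stated definition of strong convexity says nothing at points where the subdifferential of R is empty, and the claim fails for such nonconvex R (for example f(x) = x², R(x) = −x²/2, μ = 5). *)

theory Defs
  imports "HOL-Probability.Probability"
begin

section \<open>Euclidean spaces of all dimensions inside one type\<close>

text \<open>
  The constant in the complexity bounds must not depend on the dimension \<open>d\<close>, so \<open>d\<close> has to be
  quantified inside the statement and cannot be a type.  We therefore work in the inner product
  space of finitely supported real sequences, with the Euclidean inner product, and take
  \<open>\<real>\<^sup>d\<close> to be the subspace of sequences vanishing from index \<open>d\<close> on.
\<close>

typedef fseq = "{x :: nat \<Rightarrow> real. finite {i. x i \<noteq> 0}}"
  morphisms coord Abs_fseq
  by (rule exI[of _ "\<lambda>_. 0"]) simp

setup_lifting type_definition_fseq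

lemma finite_coord: "finite {i. coord x i \<noteq> 0}"
  using coord[of x] by simp

lemma fseq_eqI: "(\<And>i. coord x i = coord y i) \<Longrightarrow> x = y"
  by (simp add: coord_inject[symmetric] fun_eq_iff)

instantiation fseq :: real_vector
begin

lift_definition zero_fseq :: fseq is "\<lambda>_. 0" by simp
lift_definition plus_fseq :: "fseq \<Rightarrow> fseq \<Rightarrow> fseq" is "\<lambda>x y i. x i + y i"
  subgoal for x y
    by (rule finite_subset[of _ "{i. x i \<noteq> 0} \<union> {i. y i \<noteq> 0}"]) auto
  done
lift_definition uminus_fseq :: "fseq \<Rightarrow> fseq" is "\<lambda>x i. - x i" by simp
lift_definition minus_fseq :: "fseq \<Rightarrow> fseq \<Rightarrow> fseq" is "\<lambda>x y i. x i - y i"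
  subgoal for x y
    by (rule finite_subset[of _ "{i. x i \<noteq> 0} \<union> {i. y i \<noteq> 0}"]) auto
  done
lift_definition scaleR_fseq :: "real \<Rightarrow> fseq \<Rightarrow> fseq" is "\<lambda>r x i. r * x i"
  by (rule finite_subset[rotated]) auto

instance
  by standard (transfer; simp add: fun_eq_iff algebra_simps)+

end

lemma coord_simps [simp]:
  "coord 0 i = 0"
  "coord (x + y) i = coord x i + coord y i"
  "coord (- x) i = - coord x i"
  "coord (x - y) i = coord x i - coord y i"
  "coord (r *\<^sub>R x) i = r * coord x i"
  by (transfer; simp)+

definition fseq_ip :: "fseq \<Rightarrow> fseq \<Rightarrow> real" where
  "fseq_ip x y = (\<Sum>i | coord x i \<noteq> 0. coord x i * coord y i)"

lemma fseq_ip_superset: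
  assumes "finite A" "{i. coord x i \<noteq> 0} \<subseteq> A"
  shows "fseq_ip x y = (\<Sum>i\<in>A. coord x i * coord y i)"
  unfolding fseq_ip_def using assms by (intro sum.mono_neutral_left) auto

lemma fseq_ip_add: "fseq_ip (x + y) z = fseq_ip x z + fseq_ip y z"
proof -
  let ?A = "{i. coord x i \<noteq> 0} \<union> {i. coord y i \<noteq> 0}"
  have "finite ?A" by (simp add: finite_coord)
  then have "fseq_ip (x + y) z = (\<Sum>i\<in>?A. coord (x + y) i * coord z i)"
    "fseq_ip x z = (\<Sum>i\<in>?A. coord x i * coord z i)"
    "fseq_ip y z = (\<Sum>i\<in>?A. coord y i * coord z i)"
    by (intro fseq_ip_superset; auto)+
  then show ?thesis by (simp add: sum.distrib[symmetric] algebra_simps)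
qed

lemma fseq_ip_commute: "fseq_ip x y = fseq_ip y x"
proof -
  let ?A = "{i. coord x i \<noteq> 0} \<union> {i. coord y i \<noteq> 0}"
  have "finite ?A" by (simp add: finite_coord)
  then have "fseq_ip x y = (\<Sum>i\<in>?A. coord x i * coord y i)"
    "fseq_ip y x = (\<Sum>i\<in>?A. coord y i * coord x i)"
    by (intro fseq_ip_superset; auto)+
  then show ?thesis by (simp add: mult.commute)
qed

lemma fseq_ip_scale: "fseq_ip (r *\<^sub>R x) y = r * fseq_ip x y"
proof -
  have "fseq_ip (r *\<^sub>R x) y = (\<Sum>i | coord x i \<noteq> 0. coord (r *\<^sub>R x) i * coord y i)"
    by (intro fseq_ip_superset) (auto simp: finite_coord)
  then show ?thesis by (simp add: fseq_ip_def sum_distrib_left mult.assoc)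
qed

lemma fseq_ip_nonneg: "0 \<le> fseq_ip x x"
  by (simp add: fseq_ip_def sum_nonneg)

lemma fseq_ip_eq_0: "fseq_ip x x = 0 \<longleftrightarrow> x = 0"
proof
  assume "fseq_ip x x = 0"
  then have "coord x i * coord x i = 0" if "coord x i \<noteq> 0" for i
    using that unfolding fseq_ip_def by (subst (asm) sum_nonneg_eq_0_iff) (auto simp: finite_coord)
  then have "coord x i = 0" for i by (cases "coord x i = 0") auto
  then show "x = 0" by (intro fseq_eqI) simp
qed (simp add: fseq_ip_def)

instantiation fseq :: real_inner
begin

definition inner_fseq :: "fseq \<Rightarrow> fseq \<Rightarrow> real" where
  "inner_fseq = fseq_ip"
definition norm_fseq :: "fseq \<Rightarrow> real" where
  "norm_fseq x = sqrt (inner x x)"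
definition sgn_fseq :: "fseq \<Rightarrow> fseq" where
  "sgn_fseq x = x /\<^sub>R norm x"
definition dist_fseq :: "fseq \<Rightarrow> fseq \<Rightarrow> real" where
  "dist_fseq x y = norm (x - y)"
definition uniformity_fseq :: "(fseq \<times> fseq) filter" where
  "uniformity_fseq = (INF e\<in>{0<..}. principal {(x, y). dist x y < e})"
definition open_fseq :: "fseq set \<Rightarrow> bool" where
  "open_fseq U \<longleftrightarrow> (\<forall>x\<in>U. \<forall>\<^sub>F (x', y) in uniformity. x' = x \<longrightarrow> y \<in> U)"

instance
proof
  show "inner x y = inner y x" for x y :: fseq
    unfolding inner_fseq_def by (rule fseq_ip_commute)
qed (simp_all add: inner_fseq_def norm_fseq_def sgn_fseq_def dist_fseq_def uniformity_fseq_def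
       open_fseq_def fseq_ip_add fseq_ip_scale fseq_ip_nonneg fseq_ip_eq_0)

end

definition rspace :: "nat \<Rightarrow> fseq set" where
  "rspace d = {x. \<forall>i\<ge>d. coord x i = 0}"

lemma inner_rspace: "x \<in> rspace d \<Longrightarrow> inner x y = (\<Sum>i<d. coord x i * coord y i)"
  unfolding inner_fseq_def rspace_def
  by (intro fseq_ip_superset) (auto simp: not_le[symmetric])

lemma subspace_rspace: "subspace (rspace d)"
  by (simp add: subspace_def rspace_def)


section \<open>Gradients, subgradients, strong convexity\<close>

text \<open>The derivative is taken within \<open>\<real>\<^sup>d\<close>, so only the values of \<open>f\<close> on \<open>\<real>\<^sup>d\<close> matter.\<close>

definition nabla :: "nat \<Rightarrow> (fseq \<Rightarrow> real) \<Rightarrow> fseq \<Rightarrow> fseq" where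
  "nabla d f x =
     (THE g. g \<in> rspace d \<and> (f has_derivative (\<lambda>h. inner g h)) (at x within rspace d))"

lemma nabla_unique:
  assumes g: "g \<in> rspace d" "(f has_derivative (\<lambda>h. inner g h)) (at x within rspace d)"
    and x: "x \<in> rspace d"
  shows "nabla d f x = g"
  unfolding nabla_def
proof (rule the_equality)
  fix k assume k: "k \<in> rspace d \<and> (f has_derivative (\<lambda>h. inner k h)) (at x within rspace d)"
  let ?w = "k - g"
  have w: "?w \<in> rspace d"
    using k g(1) subspace_diff[OF subspace_rspace] by blast
  have path: "((\<lambda>t. x + t *\<^sub>R ?w) has_derivative (\<lambda>t. t *\<^sub>R ?w)) (at 0)"
    by (auto intro!: derivative_eq_intros)
  have im: "(\<lambda>t. x + t *\<^sub>R ?w) ` UNIV \<subseteq> rspace d"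
    using x w subspace_add[OF subspace_rspace] subspace_scale[OF subspace_rspace] by blast
  have "((f \<circ> (\<lambda>t. x + t *\<^sub>R ?w)) has_derivative ((\<lambda>h. inner a h) \<circ> (\<lambda>t. t *\<^sub>R ?w))) (at 0)"
    if "(f has_derivative (\<lambda>h. inner a h)) (at x within rspace d)" for a
    by (rule diff_chain_within[OF path])
      (use that im in \<open>auto intro: has_derivative_subset\<close>)
  from has_derivative_unique[OF this this] k g(2)
  have "((\<lambda>h. inner k h) \<circ> (\<lambda>t::real. t *\<^sub>R ?w)) = ((\<lambda>h. inner g h) \<circ> (\<lambda>t. t *\<^sub>R ?w))"
    by blast
  from fun_cong[OF this, of 1] have "inner ?w ?w = 0"
    by (simp add: inner_diff_left)
  then show "k = g" by simp
qed (use g in blast)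

definition subdifferential :: "nat \<Rightarrow> (fseq \<Rightarrow> real) \<Rightarrow> fseq \<Rightarrow> fseq set" where
  "subdifferential d R x = {\<xi> \<in> rspace d. \<forall>y\<in>rspace d. R y \<ge> R x + inner \<xi> (y - x)}"

definition strongly_convex :: "nat \<Rightarrow> real \<Rightarrow> (fseq \<Rightarrow> real) \<Rightarrow> bool" where
  "strongly_convex d \<mu> R \<longleftrightarrow>
     (\<forall>x\<in>rspace d. \<forall>y\<in>rspace d. \<forall>\<xi>\<in>subdifferential d R x.
        R y \<ge> R x + inner \<xi> (y - x) + \<mu> / 2 * (norm (y - x))\<^sup>2)"


section \<open>The SADA algorithm\<close>

record inner_state =
  st_x :: fseq
  st_v :: fseq
  st_u :: fseq
  st_gbar :: fseq
  st_phi :: "nat \<Rightarrow> fseq"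

text \<open>Iteration \<open>t \<ge> 1\<close> of a stage, when the index \<open>i\<close> is drawn in state \<open>st\<close>.\<close>

definition sada_step ::
  "nat \<Rightarrow> nat \<Rightarrow> (nat \<Rightarrow> fseq \<Rightarrow> real) \<Rightarrow> (fseq \<Rightarrow> real) \<Rightarrow> real \<Rightarrow> fseq \<Rightarrow> nat \<Rightarrow> nat
     \<Rightarrow> inner_state \<Rightarrow> inner_state" where
  "sada_step d n f R \<eta> v0 t i st =
     (let \<phi> = st_phi st;
          \<phi>' = \<phi>(i := st_u st);
          g = nabla d (f i) (\<phi>' i) - nabla d (f i) (\<phi> i)
              + (1 / real n) *\<^sub>R (\<Sum>j=1..n. nabla d (f j) (\<phi> j));
          gbar = (1 - 1 / real t) *\<^sub>R st_gbar st + (1 / real t) *\<^sub>R g;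
          v = arg_min_on (\<lambda>x. inner gbar x + R x + \<eta> / (2 * real t) * (norm (x - v0))\<^sup>2)
                (rspace d);
          x = arg_min_on (\<lambda>x. inner g x + R x + \<eta> * real t / 2 * (norm (x - st_u st))\<^sup>2)
                (rspace d);
          u = (1 - 1 / (real t + 1)) *\<^sub>R x + (1 / (real t + 1)) *\<^sub>R v
      in \<lparr>st_x = x, st_v = v, st_u = u, st_gbar = gbar, st_phi = \<phi>'\<rparr>)"

text \<open>Law of the state after \<open>t\<close> iterations of a stage started from \<open>x\<^sub>0\<close> and \<open>v\<^sub>0\<close>.\<close>

primrec sada_inner ::
  "nat \<Rightarrow> nat \<Rightarrow> (nat \<Rightarrow> fseq \<Rightarrow> real) \<Rightarrow> (fseq \<Rightarrow> real) \<Rightarrow> real \<Rightarrow> fseq \<Rightarrow> fseq \<Rightarrow> nat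
     \<Rightarrow> inner_state pmf" where
  "sada_inner d n f R \<eta> x0 v0 0 =
     return_pmf \<lparr>st_x = x0, st_v = v0, st_u = v0, st_gbar = 0, st_phi = (\<lambda>_. x0)\<rparr>"
| "sada_inner d n f R \<eta> x0 v0 (Suc t) =
     bind_pmf (sada_inner d n f R \<eta> x0 v0 t) (\<lambda>st.
     bind_pmf (pmf_of_set {1..n}) (\<lambda>i.
     return_pmf (sada_step d n f R \<eta> v0 (Suc t) i st)))"

text \<open>
  Joint law of the outer iterates \<open>(x\<^sub>S, v\<^sub>S)\<close> (written with a tilde in the mathematics) after
  \<open>S\<close> stages of \<open>m\<close> iterations each, started from \<open>xinit\<close>.
\<close>

primrec sada ::
  "nat \<Rightarrow> nat \<Rightarrow> (nat \<Rightarrow> fseq \<Rightarrow> real) \<Rightarrow> (fseq \<Rightarrow> real) \<Rightarrow> real \<Rightarrow> real \<Rightarrow> nat \<Rightarrow> fseq \<Rightarrow> nat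
     \<Rightarrow> (fseq \<times> fseq) pmf" where
  "sada d n f R \<eta> \<alpha> m xinit 0 = return_pmf (xinit, xinit)"
| "sada d n f R \<eta> \<alpha> m xinit (Suc s) =
     bind_pmf (sada d n f R \<eta> \<alpha> m xinit s) (\<lambda>(x, v).
     map_pmf (\<lambda>st. (st_x st, st_v st))
       (sada_inner d n f R \<eta> x ((1 - \<alpha>) *\<^sub>R v + \<alpha> *\<^sub>R x) m))"

text \<open>
  Component gradient evaluations in \<open>S\<close> stages: per stage \<open>n\<close> for the initial average and
  two per iteration (the average is afterwards updated incrementally).
\<close>

definition sada_evals :: "nat \<Rightarrow> nat \<Rightarrow> nat \<Rightarrow> nat" where
  "sada_evals n m S = (\<Sum>s=1..S. n + 2 * m)"


section \<open>The optimization problem\<close>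

definition objective ::
  "nat \<Rightarrow> (nat \<Rightarrow> fseq \<Rightarrow> real) \<Rightarrow> (fseq \<Rightarrow> real) \<Rightarrow> fseq \<Rightarrow> real" where
  "objective n f R x = (1 / real n) * (\<Sum>i=1..n. f i x) + R x"

definition Lmax :: "nat \<Rightarrow> (nat \<Rightarrow> real) \<Rightarrow> real" where
  "Lmax n L = Max (L ` {1..n})"

definition initial_gap ::
  "nat \<Rightarrow> (nat \<Rightarrow> fseq \<Rightarrow> real) \<Rightarrow> (fseq \<Rightarrow> real) \<Rightarrow> real \<Rightarrow> fseq \<Rightarrow> fseq \<Rightarrow> real" where
  "initial_gap n f R \<mu> xs xinit =
     objective n f R xinit - objective n f R xs + 3 * \<mu> / 2 * (norm (xinit - xs))\<^sup>2"

text \<open>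
  Convexity of \<open>R\<close> is listed separately because the subgradient inequality in
  \<^const>\<open>strongly_convex\<close> is vacuous at points without subgradients.
\<close>

definition sada_setting ::
  "nat \<Rightarrow> nat \<Rightarrow> (nat \<Rightarrow> fseq \<Rightarrow> real) \<Rightarrow> (nat \<Rightarrow> real) \<Rightarrow> (fseq \<Rightarrow> real) \<Rightarrow> real \<Rightarrow> fseq \<Rightarrow> fseq
     \<Rightarrow> nat \<Rightarrow> bool" where
  "sada_setting d n f L R \<mu> xs xinit m \<longleftrightarrow>
     n \<ge> 1 \<and>
     (\<forall>i\<in>{1..n}. convex_on (rspace d) (f i) \<and> f i differentiable_on rspace d \<and>
        (L i)-lipschitz_on (rspace d) (nabla d (f i))) \<and>
     Lmax n L > 0 \<and>
     \<mu> > 0 \<and> convex_on (rspace d) R \<and> strongly_convex d \<mu> R \<and>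
     is_arg_min (objective n f R) (\<lambda>x. x \<in> rspace d) xs \<and>
     xinit \<in> rspace d \<and>
     m \<ge> 1 \<and> real m = 5 * Lmax n L / (2 * \<mu>)"

end

theory Submission
  imports Defs
begin

text \<open>
  The expected value of the Lyapunov function \<open>P(x) - P(x\<^sub>*) + (3 \<mu> / 2) |v - x\<^sub>*|\<^sup>2\<close> is at least halved
  by each stage; the complexity bounds follow by counting stages.

  Within a stage, the algorithm couples a proximal gradient step, which produces \<open>x\<^sub>t\<close>, with dual
  averaging, which produces \<open>v\<^sub>t\<close>.  The proximal step is at least as good as moving from
  \<open>u\<^sub>t\<^sub>-\<^sub>1\<close>, an average of \<open>x\<^sub>t\<^sub>-\<^sub>1\<close> and \<open>v\<^sub>t\<^sub>-\<^sub>1\<close>, to the same average of \<open>x\<^sub>t\<^sub>-\<^sub>1\<close> and \<open>v\<^sub>t\<close>.  The cost of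
  that move is covered by the growth of the dual averaging model away from its previous minimizer, so
  the weighted gaps \<open>t (P(x\<^sub>t) - P(x\<^sub>*))\<close> telescope together with the excess of the model at \<open>x\<^sub>*\<close> over
  its minimum, up to an error that is the variance of the gradient estimator divided by \<open>8 L\<close>
  (\<open>step_progress\<close>).

  The variance is controlled by two quantities: the mean squared distance from the component gradients
  at \<open>x\<^sub>*\<close> to those at \<open>u\<^sub>t\<^sub>-\<^sub>1\<close>, and to those in the table.  The first is dominated by the slack in the
  convexity inequality of \<open>F\<close> between \<open>u\<^sub>t\<^sub>-\<^sub>1\<close> and \<open>x\<^sub>*\<close>.  The second decays by the factor \<open>1 - 1 / n\<close> per
  iteration, apart from the newly written entries, which are again covered by that slack.  With the
  right time dependent weight on the table error one obtains a potential that does not increase in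
  expectation (\<open>potential_decrease\<close>).  The value \<open>\<eta> = 5 L\<close> makes all these terms balance.  The choices
  of \<open>m\<close> and of the mixing weight \<open>1 / 4\<close> then turn the bound for a stage into a contraction by one half
  (\<open>stage_halves_gap\<close>).

  The iterates are defined by a choice operator, so the minimizers have to exist.  This rests on the
  existence of subgradients of finite convex functions on \<open>\<real>\<^sup>d\<close> (\<open>subdifferential_nonempty\<close>), which is
  also what makes the strong convexity hypothesis on \<open>R\<close> effective.
\<close>

section \<open>Strong convexity and minimizers\<close>

text \<open>
  Strong convexity along segments.  This form passes at once to sums and nonnegative multiples and
  yields quadratic growth at minimizers without any calculus of subgradients.  The
  modulus may be \<open>0\<close>, so linear terms fit as well.
\<close>

definition strongly_convex_on :: "'a::real_inner set \<Rightarrow> real \<Rightarrow> ('a \<Rightarrow> real) \<Rightarrow> bool" where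
  "strongly_convex_on V \<kappa> h \<longleftrightarrow>
     (\<forall>x\<in>V. \<forall>y\<in>V. \<forall>l. 0 \<le> l \<and> l \<le> 1 \<longrightarrow>
        h ((1 - l) *\<^sub>R x + l *\<^sub>R y)
          \<le> (1 - l) * h x + l * h y - \<kappa> / 2 * (l * (1 - l)) * (norm (x - y))\<^sup>2)"

lemma strongly_convex_onD:
  assumes "strongly_convex_on V \<kappa> h" "x \<in> V" "y \<in> V" "0 \<le> l" "l \<le> 1"
  shows "h ((1 - l) *\<^sub>R x + l *\<^sub>R y)
          \<le> (1 - l) * h x + l * h y - \<kappa> / 2 * (l * (1 - l)) * (norm (x - y))\<^sup>2"
  using assms unfolding strongly_convex_on_def by blast

lemma strongly_convex_on_add:
  assumes "strongly_convex_on V \<kappa> h" "strongly_convex_on V \<kappa>' k"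
  shows "strongly_convex_on V (\<kappa> + \<kappa>') (\<lambda>x. h x + k x)"
  unfolding strongly_convex_on_def
proof (intro ballI allI impI)
  fix x y l assume "x \<in> V" "y \<in> V" and l: "0 \<le> l \<and> l \<le> (1::real)"
  then show "h ((1 - l) *\<^sub>R x + l *\<^sub>R y) + k ((1 - l) *\<^sub>R x + l *\<^sub>R y)
          \<le> (1 - l) * (h x + k x) + l * (h y + k y)
             - (\<kappa> + \<kappa>') / 2 * (l * (1 - l)) * (norm (x - y))\<^sup>2"
    using strongly_convex_onD[OF assms(1), of x y l] strongly_convex_onD[OF assms(2), of x y l]
    by (simp add: algebra_simps add_divide_distrib)
qed

lemma strongly_convex_on_scale:
  assumes "strongly_convex_on V \<kappa> h" "0 \<le> c"
  shows "strongly_convex_on V (c * \<kappa>) (\<lambda>x. c * h x)"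
  unfolding strongly_convex_on_def
proof (intro ballI allI impI)
  fix x y l assume "x \<in> V" "y \<in> V" and l: "0 \<le> l \<and> l \<le> (1::real)"
  then show "c * h ((1 - l) *\<^sub>R x + l *\<^sub>R y)
          \<le> (1 - l) * (c * h x) + l * (c * h y)
             - c * \<kappa> / 2 * (l * (1 - l)) * (norm (x - y))\<^sup>2"
    using mult_left_mono[OF strongly_convex_onD[OF assms(1), of x y l] assms(2)]
    by (simp add: algebra_simps)
qed

lemma strongly_convex_on_inner: "strongly_convex_on V 0 (\<lambda>x. inner g x)"
  by (simp add: strongly_convex_on_def inner_add_right)

text \<open>
  The squared distance to a point is strongly convex with equality.  The identity serves twice: it
  gives the modulus of the proximal terms, and it bounds the distance from \<open>v\<^sub>0\<close>, a convex
  combination of two outer iterates, to the solution.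
\<close>

lemma norm_convex_combination_sq:
  fixes x y w :: "'a::real_inner"
  shows "(norm ((1 - l) *\<^sub>R x + l *\<^sub>R y - w))\<^sup>2
       = (1 - l) * (norm (x - w))\<^sup>2 + l * (norm (y - w))\<^sup>2 - l * (1 - l) * (norm (x - y))\<^sup>2"
proof -
  define a b where "a = x - w" and "b = y - w"
  have 1: "(1 - l) *\<^sub>R x + l *\<^sub>R y - w = (1 - l) *\<^sub>R a + l *\<^sub>R b" and 2: "x - y = a - b"
    unfolding a_def b_def by (simp_all add: algebra_simps)
  have "(norm ((1 - l) *\<^sub>R a + l *\<^sub>R b))\<^sup>2
      = (1 - l)\<^sup>2 * inner a a + 2 * (l * (1 - l)) * inner a b + l\<^sup>2 * inner b b"
    by (simp only: power2_norm_eq_inner)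
      (simp add: inner_add_left inner_add_right inner_commute[of b a] power2_eq_square algebra_simps)
  moreover have "(norm (a - b))\<^sup>2 = inner a a - 2 * inner a b + inner b b"
    by (simp add: power2_norm_eq_inner inner_diff_left inner_diff_right inner_commute[of b a])
  ultimately show ?thesis
    unfolding 1 2 a_def[symmetric] b_def[symmetric] power2_norm_eq_inner[of a] power2_norm_eq_inner[of b]
    by algebra
qed

lemma strongly_convex_on_norm_sq: "strongly_convex_on V c (\<lambda>x. c / 2 * (norm (x - w))\<^sup>2)"
proof -
  have "c / 2 * ((1 - l) * a + l * b - l * (1 - l) * e)
      = (1 - l) * (c / 2 * a) + l * (c / 2 * b) - c / 2 * (l * (1 - l)) * e" for a b e l :: real
    by (simp only: right_diff_distrib left_diff_distrib distrib_left mult_ac mult_1_left)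
  then show ?thesis
    unfolding strongly_convex_on_def norm_convex_combination_sq
    by (intro ballI allI impI eq_refl)
qed

text \<open>
  First order optimality in elementary form: divide by \<open>l\<close> and let \<open>l\<close> tend to \<open>0\<close>.
\<close>

lemma nonneg_linear_term:
  fixes a b :: real
  assumes "\<And>l. 0 < l \<Longrightarrow> l \<le> 1 \<Longrightarrow> 0 \<le> l * a + l\<^sup>2 * b"
  shows "0 \<le> a"
proof (rule ccontr)
  assume neg: "\<not> 0 \<le> a"
  define l where "l = min 1 (- a / (2 * (\<bar>b\<bar> + 1)))"
  have b: "0 < 2 * (\<bar>b\<bar> + 1)" by simp
  then have "0 < - a / (2 * (\<bar>b\<bar> + 1))" using neg by (intro divide_pos_pos) auto
  then have l: "0 < l" "l \<le> 1" "l \<le> - a / (2 * (\<bar>b\<bar> + 1))"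
    unfolding l_def by simp_all
  have "0 \<le> l * (a + l * b)"
    using assms[OF l(1,2)] by (simp add: algebra_simps power2_eq_square)
  then have "0 \<le> a + l * b" using l(1) by (simp add: zero_le_mult_iff)
  moreover have "l * b \<le> l * (\<bar>b\<bar> + 1)" using l(1) by (intro mult_left_mono) auto
  moreover have "l * (2 * (\<bar>b\<bar> + 1)) \<le> - a" using l(3) b by (simp only: pos_le_divide_eq)
  ultimately show False using neg by linarith
qed

text \<open>
  Compare \<open>z\<close> with the points \<open>(1 - l) z + l y\<close> and keep the terms of first order in \<open>l\<close>.
\<close>

lemma strongly_convex_on_minimum_growth:
  assumes sc: "strongly_convex_on V \<kappa> h" and V: "subspace V" and z: "z \<in> V"
    and min: "\<And>y. y \<in> V \<Longrightarrow> h z \<le> h y" and y: "y \<in> V"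
  shows "h z + \<kappa> / 2 * (norm (y - z))\<^sup>2 \<le> h y"
proof -
  let ?D = "\<kappa> / 2 * (norm (y - z))\<^sup>2"
  have "0 \<le> h y - h z - ?D"
  proof (rule nonneg_linear_term)
    fix l :: real assume l: "0 < l" "l \<le> 1"
    have "(1 - l) *\<^sub>R z + l *\<^sub>R y \<in> V"
      using V y z by (intro subspace_add subspace_scale) auto
    then have "h z \<le> h ((1 - l) *\<^sub>R z + l *\<^sub>R y)" by (rule min)
    also have "\<dots> \<le> (1 - l) * h z + l * h y - \<kappa> / 2 * (l * (1 - l)) * (norm (y - z))\<^sup>2"
      using strongly_convex_onD[OF sc z y, of l] l by (simp add: norm_minus_commute)
    finally show "0 \<le> l * (h y - h z - ?D) + l\<^sup>2 * ?D"
      by (simp add: algebra_simps diff_divide_distrib power2_eq_square)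
  qed
  then show ?thesis by simp
qed


section \<open>Subgradients and minimizers on the coordinate subspaces\<close>

lift_definition unit_seq :: "nat \<Rightarrow> fseq" is "\<lambda>k i. if i = k then 1 else 0" by simp

lemma coord_unit_seq [simp]: "coord (unit_seq k) i = (if i = k then 1 else 0)"
  by transfer simp

lemma inner_unit_seq: "inner x (unit_seq k) = coord x k"
proof -
  have "inner (unit_seq k) x = (\<Sum>i\<in>{k}. coord (unit_seq k) i * coord x i)"
    unfolding inner_fseq_def by (rule fseq_ip_superset) (auto split: if_splits)
  then show ?thesis by (simp add: inner_commute)
qed

lemma abs_coord_le_norm: "\<bar>coord x i\<bar> \<le> norm x"
proof -
  have "inner (unit_seq i) (unit_seq i) = 1" by (simp add: inner_unit_seq)
  then show ?thesis
    using Cauchy_Schwarz_ineq2[of x "unit_seq i"] by (simp add: inner_unit_seq norm_eq_sqrt_inner)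
qed

lemma coord_sum: "coord (sum g A) i = (\<Sum>a\<in>A. coord (g a) i)"
  by (induction A rule: infinite_finite_induct) auto

lemma unit_seq_in_rspace: "i < d \<Longrightarrow> unit_seq i \<in> rspace d"
  by (simp add: rspace_def)

lemma rspace_expansion:
  assumes "x \<in> rspace d"
  shows "x = (\<Sum>i<d. coord x i *\<^sub>R unit_seq i)"
proof (rule fseq_eqI)
  fix j
  show "coord x j = coord (\<Sum>i<d. coord x i *\<^sub>R unit_seq i) j"
    using assms by (auto simp: coord_sum rspace_def if_distrib cong: if_cong)
qed

lemma Cauchy_in_rspace_converges:
  assumes X: "\<And>n. X n \<in> rspace d" and C: "Cauchy X"
  shows "\<exists>l\<in>rspace d. X \<longlonglongrightarrow> l"
proof -
  have "Cauchy (\<lambda>n. coord (X n) i)" for i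
  proof (rule metric_CauchyI)
    fix e :: real assume "0 < e"
    then obtain M where M: "\<And>m n. m \<ge> M \<Longrightarrow> n \<ge> M \<Longrightarrow> norm (X m - X n) < e"
      using C unfolding Cauchy_def dist_norm by meson
    show "\<exists>M. \<forall>m\<ge>M. \<forall>n\<ge>M. dist (coord (X m) i) (coord (X n) i) < e"
    proof (intro exI[of _ M] allI impI)
      fix m n assume "m \<ge> M" "n \<ge> M"
      then show "dist (coord (X m) i) (coord (X n) i) < e"
        using M[of m n] abs_coord_le_norm[of "X m - X n" i] by (simp add: dist_real_def)
    qed
  qed
  then have "\<exists>l. (\<lambda>n. coord (X n) i) \<longlonglongrightarrow> l" for i
    using real_Cauchy_convergent convergent_def by blast
  then obtain l where l: "\<And>i. (\<lambda>n. coord (X n) i) \<longlonglongrightarrow> l i" by metis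
  have "(\<lambda>n. \<Sum>i<d. coord (X n) i *\<^sub>R unit_seq i) \<longlonglongrightarrow> (\<Sum>i<d. l i *\<^sub>R unit_seq i)"
    by (intro tendsto_sum tendsto_scaleR l tendsto_const)
  then have "X \<longlonglongrightarrow> (\<Sum>i<d. l i *\<^sub>R unit_seq i)"
    by (simp only: rspace_expansion[OF X, symmetric])
  moreover have "(\<Sum>i<d. l i *\<^sub>R unit_seq i) \<in> rspace d"
    by (intro subspace_sum[OF subspace_rspace] subspace_scale[OF subspace_rspace] unit_seq_in_rspace) auto
  ultimately show ?thesis by blast
qed

text \<open>
  The one-dimensional extension step of the Hahn--Banach theorem.  The slope \<open>c\<close> in the new direction
  must lie above all difference quotients \<open>lo\<close> taken backwards and below all quotients \<open>hi\<close> taken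
  forwards.  Such a \<open>c\<close> exists because every \<open>lo\<close> is at most every \<open>hi\<close>: weighting the two points so
  that their components along the new direction cancel gives a point of the smaller subspace, where
  the inequality is known.
\<close>

lemma subgradient_extend:
  assumes conv: "convex_on (rspace d) R" and x: "x \<in> rspace d" and k: "k < d"
    and \<xi>: "\<xi> \<in> rspace k" and sub: "\<And>w. w \<in> rspace k \<Longrightarrow> R x + inner \<xi> w \<le> R (x + w)"
  shows "\<exists>c. \<forall>w\<in>rspace k. \<forall>t. R x + inner \<xi> w + c * t \<le> R (x + w + t *\<^sub>R unit_seq k)"
proof -
  let ?e = "unit_seq k"
  define lo where "lo = (\<lambda>(w, s). (R x + inner \<xi> w - R (x + w - s *\<^sub>R ?e)) / s)"
  define hi where "hi = (\<lambda>(w, s). (R (x + w + s *\<^sub>R ?e) - R x - inner \<xi> w) / s)"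
  let ?A = "rspace k \<times> {0::real<..}"
  have inV: "x + w + t *\<^sub>R ?e \<in> rspace d" if "w \<in> rspace k" for w t
    using that x k by (auto simp: rspace_def)
  have le: "lo (w, s) \<le> hi (w', t)"
    if w: "w \<in> rspace k" "w' \<in> rspace k" and st: "0 < s" "0 < t" for w w' s t
  proof -
    let ?a = "t / (s + t)" and ?b = "s / (s + t)"
    have ab: "?a + ?b = 1" "0 \<le> ?a" "0 \<le> ?b"
      using st by (auto simp: add_divide_distrib[symmetric])
    let ?w = "?a *\<^sub>R w + ?b *\<^sub>R w'"
    have wk: "?w \<in> rspace k"
      using w by (intro subspace_add subspace_scale subspace_rspace)
    have "R x + inner \<xi> ?w \<le> R (x + ?w)" by (rule sub[OF wk])
    also have "x + ?w = ?a *\<^sub>R (x + w - s *\<^sub>R ?e) + ?b *\<^sub>R (x + w' + t *\<^sub>R ?e)"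
    proof (rule fseq_eqI)
      fix i
      have "?a * s = ?b * t" by simp
      moreover have "?a * coord x i + ?b * coord x i = coord x i"
        by (simp only: distrib_right[symmetric] ab(1) mult_1_left)
      ultimately show "coord (x + ?w) i
          = coord (?a *\<^sub>R (x + w - s *\<^sub>R ?e) + ?b *\<^sub>R (x + w' + t *\<^sub>R ?e)) i"
        by (auto simp: algebra_simps)
    qed
    also have "R \<dots> \<le> ?a * R (x + w - s *\<^sub>R ?e) + ?b * R (x + w' + t *\<^sub>R ?e)"
      using inV[OF w(1), of "- s"] inV[OF w(2), of t] ab conv
      unfolding convex_on_def by (simp del: times_divide_eq_left)
    finally have *: "(s + t) * (R x + inner \<xi> ?w)
        \<le> (s + t) * (?a * R (x + w - s *\<^sub>R ?e) + ?b * R (x + w' + t *\<^sub>R ?e))"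
      using st by (intro mult_left_mono) auto
    have st0: "s + t \<noteq> 0" using st by simp
    have mul: "(s + t) * (?a * p + ?b * q) = t * p + s * q" for p q
      using st0 by (simp add: distrib_left)
    have "(s + t) * R x + (t * inner \<xi> w + s * inner \<xi> w')
        \<le> t * R (x + w - s *\<^sub>R ?e) + s * R (x + w' + t *\<^sub>R ?e)"
      using * mul[of "inner \<xi> w" "inner \<xi> w'"] mul[of "R (x + w - s *\<^sub>R ?e)" "R (x + w' + t *\<^sub>R ?e)"]
      by (simp add: inner_add_right distrib_left)
    then show ?thesis
      using st unfolding lo_def hi_def by (simp add: field_simps)
  qed
  define c where "c = Sup (lo ` ?A)"
  have zero: "0 \<in> rspace k" by (rule subspace_0[OF subspace_rspace])
  have ne: "lo ` ?A \<noteq> {}" using zero by auto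
  have bdd: "bdd_above (lo ` ?A)"
    by (rule bdd_aboveI[where M = "hi (0, 1)"]) (use le zero in force)
  show ?thesis
  proof (intro exI[of _ c] ballI allI)
    fix w and t :: real assume w: "w \<in> rspace k"
    consider (eq) "t = 0" | (pos) "0 < t" | (neg) "t < 0" by (rule linorder_cases[of t 0])
    then show "R x + inner \<xi> w + c * t \<le> R (x + w + t *\<^sub>R ?e)"
    proof cases
      case eq then show ?thesis using sub[OF w] by simp
    next
      case pos
      have "c \<le> hi (w, t)"
        unfolding c_def by (rule cSup_least[OF ne]) (use le w pos in auto)
      then show ?thesis using pos unfolding hi_def by (simp add: field_simps)
    next
      case neg
      have "lo (w, - t) \<le> c"
        unfolding c_def by (rule cSup_upper[OF _ bdd]) (use w neg in auto)
      then show ?thesis using neg unfolding lo_def by (simp add: field_simps)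
    qed
  qed
qed

text \<open>
  Starting from the zero subspace, one coordinate direction is added at a time.
\<close>

lemma subdifferential_nonempty:
  assumes conv: "convex_on (rspace d) R" and x: "x \<in> rspace d"
  shows "\<exists>\<xi>. \<xi> \<in> subdifferential d R x"
proof -
  have "\<exists>\<xi>\<in>rspace k. \<forall>w\<in>rspace k. R x + inner \<xi> w \<le> R (x + w)" if "k \<le> d" for k
    using that
  proof (induction k)
    case 0
    have "rspace 0 = {0}" by (auto simp: rspace_def intro!: fseq_eqI)
    then show ?case by simp
  next
    case (Suc k)
    then obtain \<xi> where \<xi>: "\<xi> \<in> rspace k" "\<And>w. w \<in> rspace k \<Longrightarrow> R x + inner \<xi> w \<le> R (x + w)"
      by auto
    obtain c where c: "\<And>w t. w \<in> rspace k \<Longrightarrow>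
        R x + inner \<xi> w + c * t \<le> R (x + w + t *\<^sub>R unit_seq k)"
      using subgradient_extend[OF conv x _ \<xi>] Suc.prems by auto
    let ?\<xi> = "\<xi> + c *\<^sub>R unit_seq k"
    have "R x + inner ?\<xi> z \<le> R (x + z)" if z: "z \<in> rspace (Suc k)" for z
    proof -
      let ?w = "z - coord z k *\<^sub>R unit_seq k"
      have w: "?w \<in> rspace k"
        using z by (auto simp: rspace_def not_less_eq_eq[symmetric])
      have \<xi>k: "coord \<xi> k = 0" using \<xi>(1) by (simp add: rspace_def)
      have "inner ?\<xi> z = inner \<xi> ?w + c * coord z k"
        using \<xi>k inner_unit_seq[of z k]
        by (simp add: inner_add_left inner_diff_right inner_unit_seq inner_commute[of "unit_seq k"])
      then show ?thesis using c[OF w, of "coord z k"] by simp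
    qed
    moreover have "?\<xi> \<in> rspace (Suc k)" using \<xi>(1) by (auto simp: rspace_def)
    ultimately show ?case by blast
  qed
  then obtain \<xi> where \<xi>: "\<xi> \<in> rspace d" "\<And>w. w \<in> rspace d \<Longrightarrow> R x + inner \<xi> w \<le> R (x + w)"
    by blast
  have "R x + inner \<xi> (y - x) \<le> R y" if "y \<in> rspace d" for y
    using \<xi>(2)[of "y - x"] subspace_diff[OF subspace_rspace that x] by simp
  then show ?thesis using \<xi>(1) unfolding subdifferential_def by auto
qed

text \<open>
  A subgradient at the intermediate point bounds both end values from below; the weighted sum of the
  two inequalities cancels the linear terms.  Existence of that subgradient is what makes the
  pointwise definition equivalent to the one along segments.
\<close>

lemma strongly_convex_on_rspace:
  assumes conv: "convex_on (rspace d) R" and sc: "strongly_convex d \<mu> R"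
  shows "strongly_convex_on (rspace d) \<mu> R"
  unfolding strongly_convex_on_def
proof (intro ballI allI impI)
  fix x y l assume x: "x \<in> rspace d" and y: "y \<in> rspace d" and l: "0 \<le> l \<and> l \<le> (1::real)"
  let ?z = "(1 - l) *\<^sub>R x + l *\<^sub>R y"
  have aux: "r + M * (l * (1 - l)) * D = (1 - l) * (r + l * p + M * (l\<^sup>2 * D))
      + l * (r + (l - 1) * p + M * ((1 - l)\<^sup>2 * D))" for r M D p :: real
    by (simp add: algebra_simps power2_eq_square)
  have z: "?z \<in> rspace d"
    using x y by (intro subspace_add subspace_scale subspace_rspace)
  obtain \<xi> where \<xi>: "\<xi> \<in> subdifferential d R ?z"
    using subdifferential_nonempty[OF conv z] by blast
  have 1: "R ?z + inner \<xi> (x - ?z) + \<mu> / 2 * (norm (x - ?z))\<^sup>2 \<le> R x"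
    and 2: "R ?z + inner \<xi> (y - ?z) + \<mu> / 2 * (norm (y - ?z))\<^sup>2 \<le> R y"
    using sc z x y \<xi> unfolding strongly_convex_def by blast+
  have dx: "x - ?z = l *\<^sub>R (x - y)" and dy: "y - ?z = (l - 1) *\<^sub>R (x - y)"
    by (simp_all add: algebra_simps)
  have 3: "(1 - l) * (R ?z + l * inner \<xi> (x - y) + \<mu> / 2 * (l\<^sup>2 * (norm (x - y))\<^sup>2)) \<le> (1 - l) * R x"
    using mult_left_mono[OF 1, of "1 - l"] l unfolding dx by (simp add: power_mult_distrib)
  have 4: "l * (R ?z + (l - 1) * inner \<xi> (x - y) + \<mu> / 2 * ((1 - l)\<^sup>2 * (norm (x - y))\<^sup>2)) \<le> l * R y"
    using mult_left_mono[OF 2, of l] l unfolding dy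
    by (simp add: power_mult_distrib power2_commute[of l 1])
  have "R ?z + \<mu> / 2 * (l * (1 - l)) * (norm (x - y))\<^sup>2
      = (1 - l) * (R ?z + l * inner \<xi> (x - y) + \<mu> / 2 * (l\<^sup>2 * (norm (x - y))\<^sup>2))
      + l * (R ?z + (l - 1) * inner \<xi> (x - y) + \<mu> / 2 * ((1 - l)\<^sup>2 * (norm (x - y))\<^sup>2))"
    by (rule aux)
  then show "R ?z \<le> (1 - l) * R x + l * R y - \<mu> / 2 * (l * (1 - l)) * (norm (x - y))\<^sup>2"
    using 3 4 by linarith
qed

lemma strongly_convex_on_imp_convex_on:
  assumes "strongly_convex_on V \<kappa> h" "0 \<le> \<kappa>" "convex V"
  shows "convex_on V h"
  unfolding convex_on_def
proof (intro conjI ballI allI impI)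
  fix x y u v assume xy: "x \<in> V" "y \<in> V" and uv: "0 \<le> u" "0 \<le> v" "u + v = (1::real)"
  have u: "u = 1 - v" and v: "v \<le> 1" using uv by simp_all
  have "0 \<le> \<kappa> / 2 * (v * (1 - v)) * (norm (x - y))\<^sup>2" using uv(2) v assms(2) by simp
  then show "h (u *\<^sub>R x + v *\<^sub>R y) \<le> u * h x + v * h y"
    using strongly_convex_onD[OF assms(1) xy uv(2) v] unfolding u by linarith
qed (rule assms(3))

text \<open>
  A subgradient at \<open>0\<close> together with strong convexity bounds \<open>h\<close> from below.  By strong convexity at
  midpoints every minimizing sequence is Cauchy, hence convergent in \<open>\<real>\<^sup>d\<close>, and a subgradient at the
  limit supplies the lower semicontinuity that makes the limit a minimizer.
\<close>

lemma strongly_convex_on_has_minimizer: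
  assumes sc: "strongly_convex_on (rspace d) \<kappa> h" and \<kappa>: "0 < \<kappa>"
  shows "\<exists>z\<in>rspace d. \<forall>y\<in>rspace d. h z \<le> h y"
proof -
  let ?V = "rspace d"
  have conv: "convex_on ?V h"
    using strongly_convex_on_imp_convex_on[OF sc] \<kappa> subspace_imp_convex[OF subspace_rspace] by simp
  have zero: "0 \<in> ?V" by (rule subspace_0[OF subspace_rspace])
  obtain \<xi> where \<xi>: "\<And>y. y \<in> ?V \<Longrightarrow> h 0 + inner \<xi> y \<le> h y"
    using subdifferential_nonempty[OF conv zero] unfolding subdifferential_def by auto
  have low: "h 0 - (norm \<xi>)\<^sup>2 / \<kappa> \<le> h y" if y: "y \<in> ?V" for y
  proof -
    have "h 0 + inner \<xi> ((1/2) *\<^sub>R y) \<le> h ((1/2) *\<^sub>R y)"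
      by (rule \<xi>) (rule subspace_scale[OF subspace_rspace y])
    also have "\<dots> \<le> 1/2 * h 0 + 1/2 * h y - \<kappa> / 8 * (norm y)\<^sup>2"
      using strongly_convex_onD[OF sc zero y, of "1/2"] by simp
    finally have "h 0 + inner \<xi> y + \<kappa> / 4 * (norm y)\<^sup>2 \<le> h y" by simp
    moreover have "- (norm \<xi> * norm y) \<le> inner \<xi> y"
      using Cauchy_Schwarz_ineq2[of \<xi> y] by linarith
    moreover have "(norm \<xi>)\<^sup>2 / \<kappa> - norm \<xi> * norm y + \<kappa> / 4 * (norm y)\<^sup>2
        = (norm \<xi> - \<kappa> / 2 * norm y)\<^sup>2 / \<kappa>"
      using \<kappa> by (simp add: field_simps power2_eq_square)
    moreover have "0 \<le> (norm \<xi> - \<kappa> / 2 * norm y)\<^sup>2 / \<kappa>" using \<kappa> by simp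
    ultimately show ?thesis by linarith
  qed
  define I where "I = Inf (h ` ?V)"
  have bdd: "bdd_below (h ` ?V)" using low by (intro bdd_belowI[where m = "h 0 - (norm \<xi>)\<^sup>2 / \<kappa>"]) auto
  have I: "I \<le> h y" if "y \<in> ?V" for y
    unfolding I_def using that bdd by (intro cInf_lower) auto
  have "\<exists>y\<in>?V. h y < I + inverse (real (Suc n))" for n
    using cInf_less_iff[OF _ bdd, of "I + inverse (real (Suc n))"] zero
    unfolding I_def by auto
  then obtain X where X: "\<And>n. X n \<in> ?V" "\<And>n. h (X n) < I + inverse (real (Suc n))"
    by metis
  \<comment> \<open>The value at the midpoint cannot fall below the infimum, so two almost minimal points are close.\<close>
  have close: "\<kappa> / 8 * (norm (X m - X n))\<^sup>2 \<le> inverse (real (Suc N))" if "m \<ge> N" "n \<ge> N" for m n N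
  proof -
    have 1: "I \<le> h ((1 - 1/2) *\<^sub>R X m + (1/2) *\<^sub>R X n)"
      by (intro I subspace_add subspace_scale subspace_rspace X)
    have 2: "h ((1 - 1/2) *\<^sub>R X m + (1/2) *\<^sub>R X n)
        \<le> 1/2 * h (X m) + 1/2 * h (X n) - \<kappa> / 8 * (norm (X m - X n))\<^sup>2"
      using strongly_convex_onD[OF sc X(1) X(1), of "1/2"] by simp
    have 3: "h (X i) \<le> I + inverse (real (Suc N))" if "N \<le> i" for i
    proof -
      have "inverse (real (Suc i)) \<le> inverse (real (Suc N))"
        using that by (intro le_imp_inverse_le) auto
      then show ?thesis using X(2)[of i] by linarith
    qed
    show ?thesis using 1 2 3[OF that(1)] 3[OF that(2)] by linarith
  qed
  have "Cauchy X"
  proof (rule metric_CauchyI)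
    fix e :: real assume e: "0 < e"
    then have "0 < \<kappa> / 8 * e\<^sup>2" using \<kappa> by simp
    then obtain N where N: "inverse (real (Suc N)) < \<kappa> / 8 * e\<^sup>2" using reals_Archimedean by blast
    show "\<exists>M. \<forall>m\<ge>M. \<forall>n\<ge>M. dist (X m) (X n) < e"
    proof (intro exI[of _ N] allI impI)
      fix m n assume "m \<ge> N" "n \<ge> N"
      then have "\<kappa> / 8 * (norm (X m - X n))\<^sup>2 < \<kappa> / 8 * e\<^sup>2"
        by (rule le_less_trans[OF close N])
      then have "(norm (X m - X n))\<^sup>2 < e\<^sup>2" using \<kappa> by simp
      then show "dist (X m) (X n) < e" using e by (simp add: dist_norm power_less_imp_less_base)
    qed
  qed
  then obtain z where z: "z \<in> ?V" "X \<longlonglongrightarrow> z"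
    using Cauchy_in_rspace_converges X(1) by blast
  obtain \<zeta> where \<zeta>: "\<And>y. y \<in> ?V \<Longrightarrow> h z + inner \<zeta> (y - z) \<le> h y"
    using subdifferential_nonempty[OF conv z(1)] unfolding subdifferential_def by auto
  have "(\<lambda>n. h z + inner \<zeta> (X n - z)) \<longlonglongrightarrow> h z + inner \<zeta> (z - z)"
    by (intro tendsto_intros z(2))
  moreover have "(\<lambda>n. I + inverse (real (Suc n))) \<longlonglongrightarrow> I + 0"
    by (intro tendsto_intros LIMSEQ_inverse_real_of_nat)
  moreover have "h z + inner \<zeta> (X n - z) \<le> I + inverse (real (Suc n))" for n
    using \<zeta>[OF X(1)] X(2)[of n] by (meson less_imp_le order_trans)
  ultimately have "h z \<le> I" using LIMSEQ_le by fastforce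
  then show ?thesis using z(1) I by force
qed

text \<open>
  The choice operator in the two proximal updates therefore returns a genuine minimizer, with
  quadratic growth around it.
\<close>

lemma arg_min_on_rspace:
  assumes "strongly_convex_on (rspace d) \<kappa> h" "0 < \<kappa>"
  shows "arg_min_on h (rspace d) \<in> rspace d"
    and "y \<in> rspace d \<Longrightarrow>
      h (arg_min_on h (rspace d)) + \<kappa> / 2 * (norm (y - arg_min_on h (rspace d)))\<^sup>2 \<le> h y"
proof -
  let ?z = "arg_min_on h (rspace d)"
  obtain z where "z \<in> rspace d" "\<forall>y\<in>rspace d. h z \<le> h y"
    using strongly_convex_on_has_minimizer[OF assms] by blast
  then have "is_arg_min h (\<lambda>x. x \<in> rspace d) z" unfolding is_arg_min_def by (auto simp: not_less)
  then have z: "is_arg_min h (\<lambda>x. x \<in> rspace d) ?z"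
    unfolding arg_min_on_def arg_min_def by (rule someI)
  then show V: "?z \<in> rspace d" unfolding is_arg_min_def by simp
  have "h ?z \<le> h y" if "y \<in> rspace d" for y
    using z that unfolding is_arg_min_def by (auto simp: not_less)
  then show "h ?z + \<kappa> / 2 * (norm (y - ?z))\<^sup>2 \<le> h y" if "y \<in> rspace d"
    using strongly_convex_on_minimum_growth[OF assms(1) subspace_rspace V] that by blast
qed


section \<open>Convex functions with Lipschitz gradient\<close>

definition smooth_convex_on ::
  "'a::real_inner set \<Rightarrow> real \<Rightarrow> ('a \<Rightarrow> real) \<Rightarrow> ('a \<Rightarrow> 'a) \<Rightarrow> bool" where
  "smooth_convex_on V L f G \<longleftrightarrow> convex_on V f \<and>
     (\<forall>x\<in>V. G x \<in> V \<and> (f has_derivative (\<lambda>h. inner (G x) h)) (at x within V)) \<and>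
     (\<forall>x\<in>V. \<forall>y\<in>V. norm (G x - G y) \<le> L * norm (x - y))"

lemma smooth_convex_onD:
  assumes "smooth_convex_on V L f G"
  shows "convex_on V f"
    and "x \<in> V \<Longrightarrow> G x \<in> V"
    and "x \<in> V \<Longrightarrow> (f has_derivative (\<lambda>h. inner (G x) h)) (at x within V)"
    and "x \<in> V \<Longrightarrow> y \<in> V \<Longrightarrow> norm (G x - G y) \<le> L * norm (x - y)"
  using assms unfolding smooth_convex_on_def by auto

lemma smooth_convex_on_line_derivative:
  assumes sm: "smooth_convex_on V L f G" and V: "subspace V" and x: "x \<in> V" and w: "w \<in> V"
  shows "((\<lambda>t. f (x + t *\<^sub>R w)) has_real_derivative inner (G (x + t *\<^sub>R w)) w) (at t)"
proof -
  have xt: "x + t *\<^sub>R w \<in> V" for t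
    using V x w by (intro subspace_add subspace_scale)
  have path: "((\<lambda>t. x + t *\<^sub>R w) has_derivative (\<lambda>t. t *\<^sub>R w)) (at t)"
    by (auto intro!: derivative_eq_intros)
  have "((f \<circ> (\<lambda>t. x + t *\<^sub>R w)) has_derivative
      ((\<lambda>h. inner (G (x + t *\<^sub>R w)) h) \<circ> (\<lambda>t. t *\<^sub>R w))) (at t)"
    by (rule diff_chain_within[OF path])
      (rule has_derivative_subset[OF smooth_convex_onD(3)[OF sm xt]], use xt in auto)
  moreover have "(\<lambda>h. inner (G (x + t *\<^sub>R w)) h) \<circ> (\<lambda>t. t *\<^sub>R w) = (*) (inner (G (x + t *\<^sub>R w)) w)"
    by (auto simp: fun_eq_iff mult.commute)
  ultimately show ?thesis
    unfolding has_field_derivative_def by (simp add: o_def)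
qed

lemma smooth_convex_on_above_tangent:
  assumes sm: "smooth_convex_on V L f G" and V: "subspace V" and x: "x \<in> V" and y: "y \<in> V"
  shows "f x + inner (G x) (y - x) \<le> f y"
proof -
  let ?p = "\<lambda>t. f (x + t *\<^sub>R (y - x))"
  have w: "y - x \<in> V" by (rule subspace_diff[OF V y x])
  have xt: "x + t *\<^sub>R (y - x) \<in> V" for t
    using V x w by (intro subspace_add subspace_scale)
  have "convex_on UNIV ?p"
  proof (rule convex_onI)
    fix l a b :: real assume l: "0 < l" "l < 1"
    have "x + ((1 - l) *\<^sub>R a + l *\<^sub>R b) *\<^sub>R (y - x)
        = (1 - l) *\<^sub>R (x + a *\<^sub>R (y - x)) + l *\<^sub>R (x + b *\<^sub>R (y - x))"
      by (simp add: algebra_simps)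
    then show "?p ((1 - l) *\<^sub>R a + l *\<^sub>R b) \<le> (1 - l) * ?p a + l * ?p b"
      using convex_onD[OF smooth_convex_onD(1)[OF sm], of l] l xt by simp
  qed simp
  then have "?p 1 - ?p 0 \<ge> inner (G (x + 0 *\<^sub>R (y - x))) (y - x) * (1 - 0)"
    by (rule convex_on_imp_above_tangent)
      (use smooth_convex_on_line_derivative[OF sm V x w, of 0] in simp_all)
  then show ?thesis by simp
qed

text \<open>
  Along the segment, the difference of \<open>f\<close> and the quadratic model has a nonpositive derivative, since
  the gradient moves by at most \<open>L t\<close> times the length of the segment.
\<close>

lemma smooth_convex_on_descent:
  assumes sm: "smooth_convex_on V L f G" and V: "subspace V" and x: "x \<in> V" and y: "y \<in> V"
  shows "f y \<le> f x + inner (G x) (y - x) + L / 2 * (norm (y - x))\<^sup>2"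
proof -
  let ?w = "y - x"
  let ?p = "\<lambda>t. f (x + t *\<^sub>R ?w) - t * inner (G x) ?w - L * t\<^sup>2 / 2 * (norm ?w)\<^sup>2"
  have w: "?w \<in> V" by (rule subspace_diff[OF V y x])
  have xt: "x + t *\<^sub>R ?w \<in> V" for t
    using V x w by (intro subspace_add subspace_scale)
  have "?p 1 \<le> ?p 0"
  proof (rule DERIV_nonpos_imp_nonincreasing[of 0 1 ?p])
    fix t :: real assume t: "0 \<le> t" "t \<le> 1"
    have "(?p has_real_derivative inner (G (x + t *\<^sub>R ?w)) ?w - inner (G x) ?w - L * t * (norm ?w)\<^sup>2) (at t)"
      by (auto intro!: derivative_eq_intros smooth_convex_on_line_derivative[OF sm V x w])
    moreover have "inner (G (x + t *\<^sub>R ?w) - G x) ?w \<le> L * t * (norm ?w)\<^sup>2"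
    proof -
      have "inner (G (x + t *\<^sub>R ?w) - G x) ?w \<le> norm (G (x + t *\<^sub>R ?w) - G x) * norm ?w"
        by (rule norm_cauchy_schwarz)
      also have "\<dots> \<le> (L * norm (x + t *\<^sub>R ?w - x)) * norm ?w"
        by (intro mult_right_mono smooth_convex_onD(4)[OF sm] xt x) simp
      also have "\<dots> = L * t * (norm ?w)\<^sup>2" using t by (simp add: power2_eq_square)
      finally show ?thesis .
    qed
    ultimately show "\<exists>D. (?p has_real_derivative D) (at t) \<and> D \<le> 0"
      unfolding inner_diff_left by fastforce
  qed simp
  then show ?thesis by simp
qed

text \<open>
  The tangent inequality, improved by the distance of the gradients.  Take a gradient step from
  \<open>y\<close> for the function \<open>f\<close> minus its linearization at \<open>x\<close>: that function is minimal at \<open>x\<close>, and the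
  descent lemma says how far the step of length \<open>1 / L\<close> lowers it.
\<close>

lemma smooth_convex_on_gradient_gap:
  assumes sm: "smooth_convex_on V L f G" and V: "subspace V" and L: "0 < L"
    and x: "x \<in> V" and y: "y \<in> V"
  shows "f x + inner (G x) (y - x) + (norm (G y - G x))\<^sup>2 / (2 * L) \<le> f y"
proof -
  let ?\<delta> = "G y - G x"
  \<comment> \<open>The gradient step that is optimal for the quadratic upper model at \<open>y\<close>.\<close>
  let ?z = "y - (1 / L) *\<^sub>R ?\<delta>"
  have z: "?z \<in> V"
    using V x y smooth_convex_onD(2)[OF sm] by (intro subspace_diff subspace_scale)
  have 1: "f x + inner (G x) (?z - x) \<le> f ?z"
    by (rule smooth_convex_on_above_tangent[OF sm V x z])
  have 2: "f ?z \<le> f y + inner (G y) (?z - y) + L / 2 * (norm (?z - y))\<^sup>2"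
    by (rule smooth_convex_on_descent[OF sm V y z])
  have 3: "L / 2 * (norm (?z - y))\<^sup>2 = (norm ?\<delta>)\<^sup>2 / (2 * L)"
    using L by (simp add: power_mult_distrib power_divide power2_eq_square)
  have 4: "inner (G x) (?z - x) = inner (G x) (y - x) - inner (G x) ?\<delta> / L"
    and 5: "inner (G y) (?z - y) = - (inner (G y) ?\<delta> / L)"
    by (simp_all add: inner_diff_right)
  have "inner (G y) ?\<delta> / L - inner (G x) ?\<delta> / L = inner ?\<delta> ?\<delta> / L"
    by (simp only: inner_diff_left diff_divide_distrib)
  then have 6: "inner (G y) ?\<delta> / L - inner (G x) ?\<delta> / L = 2 * ((norm ?\<delta>)\<^sup>2 / (2 * L))"
    by (simp add: power2_norm_eq_inner)
  show ?thesis using 1 2 6 unfolding 3 4 5 by linarith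
qed

text \<open>
  The derivative within \<open>\<real>\<^sup>d\<close> is a linear functional of the whole sequence space, of which only the
  restriction to \<open>\<real>\<^sup>d\<close> matters; its values on the coordinate vectors are the entries of the gradient.
\<close>

lemma nabla_has_derivative:
  assumes diff: "f differentiable_on rspace d" and x: "x \<in> rspace d"
  shows "nabla d f x \<in> rspace d"
    and "(f has_derivative (\<lambda>h. inner (nabla d f x) h)) (at x within rspace d)"
proof -
  obtain D where D: "(f has_derivative D) (at x within rspace d)"
    using diff x unfolding differentiable_on_def differentiable_def by blast
  interpret D: bounded_linear D by (rule has_derivative_bounded_linear[OF D])
  define g where "g = (\<Sum>i<d. D (unit_seq i) *\<^sub>R unit_seq i)"
  have g: "g \<in> rspace d"
    unfolding g_def
    by (intro subspace_sum[OF subspace_rspace] subspace_scale[OF subspace_rspace] unit_seq_in_rspace) auto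
  have Dg: "D h = inner g h" if "h \<in> rspace d" for h
  proof -
    have "D h = D (\<Sum>i<d. coord h i *\<^sub>R unit_seq i)" using rspace_expansion[OF that] by simp
    also have "\<dots> = (\<Sum>i<d. coord h i * D (unit_seq i))" by (simp add: D.sum D.scaleR)
    also have "\<dots> = inner g h"
      unfolding g_def
      by (simp add: inner_sum_left inner_commute[of "unit_seq _" h] inner_unit_seq mult.commute)
    finally show ?thesis .
  qed
  have "(f has_derivative (\<lambda>h. inner g h)) (at x within rspace d)"
    unfolding has_derivative_within
  proof
    have "\<forall>\<^sub>F y in at x within rspace d. (1 / norm (y - x)) *\<^sub>R (f y - (f x + D (y - x)))
        = (1 / norm (y - x)) *\<^sub>R (f y - (f x + inner g (y - x)))"
      unfolding eventually_at_filter
      by (intro always_eventually allI impI) (simp add: Dg subspace_diff[OF subspace_rspace _ x])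
    then show "((\<lambda>y. (1 / norm (y - x)) *\<^sub>R (f y - (f x + inner g (y - x)))) \<longlongrightarrow> 0)
        (at x within rspace d)"
      using D unfolding has_derivative_within by (auto intro: Lim_transform_eventually)
  qed (rule bounded_linear_inner_right)
  moreover from this have "nabla d f x = g" by (intro nabla_unique g x)
  ultimately show "nabla d f x \<in> rspace d"
    and "(f has_derivative (\<lambda>h. inner (nabla d f x) h)) (at x within rspace d)"
    using g by auto
qed


section \<open>One iteration\<close>

lemma norm_diff_sq_le:
  fixes a b s :: "'a::real_inner"
  shows "(norm (a - b))\<^sup>2 \<le> 2 * (norm (a - s))\<^sup>2 + 2 * (norm (b - s))\<^sup>2"
proof -
  have "(norm (p - q))\<^sup>2 + (norm (p + q))\<^sup>2 = 2 * (norm p)\<^sup>2 + 2 * (norm q)\<^sup>2" for p q :: 'a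
    by (simp only: power2_norm_eq_inner)
      (simp add: inner_diff_left inner_diff_right inner_add_left inner_add_right)
  from this[of "a - s" "b - s"] show ?thesis using zero_le_power2[of "norm (a - s + (b - s))"]
    by (simp only: diff_diff_eq2 diff_add_cancel)
qed

text \<open>
  Centring at the mean lowers the sum of squares; this is the bound of a variance by a second moment.
\<close>

lemma sum_sq_deviation_le:
  fixes X :: "'b \<Rightarrow> 'a::real_inner"
  shows "(\<Sum>i\<in>I. (norm (X i - (1 / real (card I)) *\<^sub>R sum X I))\<^sup>2) \<le> (\<Sum>i\<in>I. (norm (X i))\<^sup>2)"
proof (cases "card I = 0")
  case False
  define c where "c = (1 / real (card I)) *\<^sub>R sum X I"
  have sum: "sum X I = real (card I) *\<^sub>R c" using False by (simp add: c_def)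
  have "(norm (X i - c))\<^sup>2 = (norm (X i))\<^sup>2 - 2 * inner (X i) c + (norm c)\<^sup>2" for i
    by (simp only: power2_norm_eq_inner)
      (simp add: inner_diff_left inner_diff_right inner_commute)
  then have "(\<Sum>i\<in>I. (norm (X i - c))\<^sup>2)
      = (\<Sum>i\<in>I. (norm (X i))\<^sup>2) - 2 * inner (sum X I) c + real (card I) * (norm c)\<^sup>2"
    by (simp add: sum.distrib sum_subtractf sum_distrib_left inner_sum_left)
  also have "\<dots> = (\<Sum>i\<in>I. (norm (X i))\<^sup>2) - real (card I) * (norm c)\<^sup>2"
    unfolding sum by (simp add: power2_norm_eq_inner)
  finally show ?thesis unfolding c_def[symmetric] by simp
qed (auto simp: card_eq_0_iff)

lemma sum_fun_upd:
  fixes h :: "'b \<Rightarrow> 'c \<Rightarrow> real"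
  assumes "finite I" "i \<in> I"
  shows "(\<Sum>j\<in>I. h j ((\<phi>(i := u)) j)) = (\<Sum>j\<in>I. h j (\<phi> j)) + (h i u - h i (\<phi> i))"
proof -
  have "(\<Sum>j\<in>I - {i}. h j ((\<phi>(i := u)) j)) = (\<Sum>j\<in>I - {i}. h j (\<phi> j))"
    by (intro sum.cong) auto
  then show ?thesis
    using sum.remove[OF assms, of "\<lambda>j. h j ((\<phi>(i := u)) j)"]
      sum.remove[OF assms, of "\<lambda>j. h j (\<phi> j)"] by simp
qed

lemma inner_le_Young:
  fixes a b :: "'a::real_inner"
  assumes "0 < \<beta>"
  shows "inner a b \<le> (norm a)\<^sup>2 / (2 * \<beta>) + \<beta> / 2 * (norm b)\<^sup>2"
proof -
  have "(norm a)\<^sup>2 / (2 * \<beta>) + \<beta> / 2 * (norm b)\<^sup>2 - norm a * norm b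
      = (norm a - \<beta> * norm b)\<^sup>2 / (2 * \<beta>)"
    using assms by (simp add: field_simps power2_eq_square)
  moreover have "0 \<le> (norm a - \<beta> * norm b)\<^sup>2 / (2 * \<beta>)" using assms by simp
  ultimately show ?thesis using norm_cauchy_schwarz[of a b] by linarith
qed

text \<open>
  The hypotheses in the form in which the analysis uses them: one Lipschitz constant \<open>L\<close> for all
  component gradients, in the role of \<open>L\<^sub>m\<^sub>a\<^sub>x\<close>.
\<close>

locale sada_problem =
  fixes d n :: nat and f :: "nat \<Rightarrow> fseq \<Rightarrow> real" and R :: "fseq \<Rightarrow> real"
    and L \<mu> :: real and xs :: fseq
  assumes n: "1 \<le> n" and L: "0 < L" and \<mu>: "0 < \<mu>"
    and smooth: "\<And>i. i \<in> {1..n} \<Longrightarrow> smooth_convex_on (rspace d) L (f i) (nabla d (f i))"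
    and convR: "convex_on (rspace d) R" and scR: "strongly_convex d \<mu> R"
    and opt: "is_arg_min (objective n f R) (\<lambda>x. x \<in> rspace d) xs"
begin

abbreviation "V \<equiv> rspace d"
abbreviation "P \<equiv> objective n f R"

definition F :: "fseq \<Rightarrow> real" where
  "F x = (1 / real n) * (\<Sum>i=1..n. f i x)"

definition grad :: "nat \<Rightarrow> fseq \<Rightarrow> fseq" where
  "grad i = nabla d (f i)"

definition gradF :: "fseq \<Rightarrow> fseq" where
  "gradF x = (1 / real n) *\<^sub>R (\<Sum>i=1..n. grad i x)"

text \<open>
  How far the table of stored points is from having the gradients of the solution.  It governs the
  variance of the gradient estimator.
\<close>

definition grad_error :: "(nat \<Rightarrow> fseq) \<Rightarrow> real" where
  "grad_error \<phi> = (1 / real n) * (\<Sum>j=1..n. (norm (grad j (\<phi> j) - grad j xs))\<^sup>2)"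

lemma P_eq: "P x = F x + R x"
  by (simp add: objective_def F_def)

lemma xs_in: "xs \<in> V" and xs_min: "y \<in> V \<Longrightarrow> P xs \<le> P y"
  using opt unfolding is_arg_min_def by (auto simp: not_less)

lemmas V_intros = subspace_add[OF subspace_rspace] subspace_scale[OF subspace_rspace]
  subspace_diff[OF subspace_rspace] subspace_0[OF subspace_rspace] subspace_sum[OF subspace_rspace]

lemma grad_in: "i \<in> {1..n} \<Longrightarrow> x \<in> V \<Longrightarrow> grad i x \<in> V"
  unfolding grad_def by (rule smooth_convex_onD(2)[OF smooth])

lemma gradF_in: "x \<in> V \<Longrightarrow> gradF x \<in> V"
  unfolding gradF_def by (intro V_intros grad_in) auto

lemma R_strongly_convex: "strongly_convex_on V \<mu> R"
  by (rule strongly_convex_on_rspace[OF convR scR])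

lemma grad_error_nonneg: "0 \<le> grad_error \<phi>"
  by (simp add: grad_error_def sum_nonneg)

lemma average_le:
  assumes "\<And>i. i \<in> {1..n} \<Longrightarrow> a i \<le> (b i :: real)"
  shows "(1 / real n) * (\<Sum>i=1..n. a i) \<le> (1 / real n) * (\<Sum>i=1..n. b i)"
  by (intro mult_left_mono sum_mono assms) auto

lemma average_const: "(1 / real n) * (\<Sum>i=1..n. c) = c"
  using n by simp

text \<open>
  Averaging the componentwise inequalities keeps the gradient distances inside the average.  This is
  stronger than applying the lemma to \<open>F\<close>, and it is the form that matches the variance of the
  estimator.
\<close>

lemma F_gradient_gap:
  assumes "x \<in> V" "y \<in> V"
  shows "F x + inner (gradF x) (y - x)
      + (1 / real n) * (\<Sum>i=1..n. (norm (grad i y - grad i x))\<^sup>2) / (2 * L) \<le> F y"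
proof -
  have "(1 / real n) * (\<Sum>i=1..n. f i x + inner (grad i x) (y - x)
      + (norm (grad i y - grad i x))\<^sup>2 / (2 * L)) \<le> F y"
    unfolding F_def
    by (intro average_le)
      (use smooth_convex_on_gradient_gap[OF smooth subspace_rspace L assms] in \<open>simp add: grad_def\<close>)
  then show ?thesis
    by (simp add: F_def gradF_def sum.distrib inner_sum_left sum_divide_distrib[symmetric]
        distrib_left)
qed

lemma F_above_tangent:
  assumes "x \<in> V" "y \<in> V"
  shows "F x + inner (gradF x) (y - x) \<le> F y"
proof -
  have "0 \<le> (1 / real n) * (\<Sum>i=1..n. (norm (grad i y - grad i x))\<^sup>2) / (2 * L)"
    using L by (intro divide_nonneg_nonneg mult_nonneg_nonneg sum_nonneg) auto
  then show ?thesis using F_gradient_gap[OF assms] by linarith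
qed

lemma F_descent:
  assumes "x \<in> V" "y \<in> V"
  shows "F y \<le> F x + inner (gradF x) (y - x) + L / 2 * (norm (y - x))\<^sup>2"
proof -
  have "F y \<le> (1 / real n) * (\<Sum>i=1..n. f i x + inner (grad i x) (y - x)
      + L / 2 * (norm (y - x))\<^sup>2)"
    unfolding F_def
    by (intro average_le)
      (use smooth_convex_on_descent[OF smooth subspace_rspace assms] in \<open>simp add: grad_def\<close>)
  then show ?thesis
    using average_const[of "L / 2 * (norm (y - x))\<^sup>2"]
    by (simp only: sum.distrib distrib_left F_def gradF_def inner_scaleR_left inner_sum_left)
qed

text \<open>
  The optimality condition of \<open>P = F + R\<close> at the solution: move from the solution towards \<open>y\<close>, bound
  \<open>F\<close> by the descent lemma and \<open>R\<close> by convexity, and keep the first order terms.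
\<close>

lemma minus_gradF_subgradient: "- gradF xs \<in> subdifferential d R xs"
  unfolding subdifferential_def
proof (intro CollectI conjI ballI)
  show "- gradF xs \<in> V" using V_intros(2)[OF gradF_in[OF xs_in], of "-1"] by simp
  fix y assume y: "y \<in> V"
  let ?b = "L / 2 * (norm (y - xs))\<^sup>2"
  have "0 \<le> inner (gradF xs) (y - xs) + (R y - R xs)"
  proof (rule nonneg_linear_term)
    fix l :: real assume l: "0 < l" "l \<le> 1"
    let ?z = "(1 - l) *\<^sub>R xs + l *\<^sub>R y"
    have z: "?z \<in> V" by (intro V_intros xs_in y)
    have zx: "?z - xs = l *\<^sub>R (y - xs)" by (simp add: algebra_simps)
    have "F ?z \<le> F xs + l * inner (gradF xs) (y - xs) + l\<^sup>2 * ?b"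
      using F_descent[OF xs_in z] unfolding zx by (simp add: power_mult_distrib mult_ac)
    moreover have "R ?z \<le> (1 - l) * R xs + l * R y"
      using convex_onD[OF convR, of l xs y] l xs_in y by simp
    ultimately show "0 \<le> l * (inner (gradF xs) (y - xs) + (R y - R xs)) + l\<^sup>2 * ?b"
      using xs_min[OF z] unfolding P_eq by (simp add: algebra_simps)
  qed
  then show "R xs + inner (- gradF xs) (y - xs) \<le> R y" by simp
qed

text \<open>
  At the start of a stage all table entries equal the outer iterate.  The term with \<open>\<mu>\<close> is kept
  because it later cancels the share of the outer iterate in \<open>v\<^sub>0\<close>.
\<close>

lemma grad_error_const_le:
  assumes x: "x \<in> V"
  shows "grad_error (\<lambda>_. x) \<le> 2 * L * (P x - P xs - \<mu> / 2 * (norm (x - xs))\<^sup>2)"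
proof -
  have "R xs + inner (- gradF xs) (x - xs) + \<mu> / 2 * (norm (x - xs))\<^sup>2 \<le> R x"
    using scR minus_gradF_subgradient xs_in x unfolding strongly_convex_def by blast
  moreover have "F xs + inner (gradF xs) (x - xs) + grad_error (\<lambda>_. x) / (2 * L) \<le> F x"
    using F_gradient_gap[OF xs_in x] unfolding grad_error_def .
  ultimately have "grad_error (\<lambda>_. x) / (2 * L) \<le> P x - P xs - \<mu> / 2 * (norm (x - xs))\<^sup>2"
    unfolding P_eq by simp
  then show ?thesis using L by (simp add: field_simps)
qed

text \<open>
  The stochastic gradient \<open>g\<^sub>t\<close> when the index \<open>i\<close> is drawn.
\<close>

definition estimator :: "nat \<Rightarrow> inner_state \<Rightarrow> fseq" where
  "estimator i st = grad i (st_u st) - grad i (st_phi st i)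
     + (1 / real n) *\<^sub>R (\<Sum>j=1..n. grad j (st_phi st j))"

lemma estimator_unbiased:
  "(1 / real n) * (\<Sum>i=1..n. inner (estimator i st) w) = inner (gradF (st_u st)) w"
proof -
  have "(\<Sum>i=1..n. estimator i st) = real n *\<^sub>R gradF (st_u st)"
    using n by (simp add: estimator_def gradF_def sum.distrib sum_subtractf scaleR_sum_right[symmetric]
        sum_constant_scaleR)
  then show ?thesis
    using n by (simp add: inner_sum_left[symmetric])
qed

text \<open>
  The deviation from the mean is that of the differences of gradients at \<open>u\<close> and at the table entries.
  Both are compared with the gradients at the solution.
\<close>

lemma estimator_variance:
  "(1 / real n) * (\<Sum>i=1..n. (norm (gradF (st_u st) - estimator i st))\<^sup>2)
     \<le> 2 * grad_error (\<lambda>_. st_u st) + 2 * grad_error (st_phi st)"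
proof -
  let ?X = "\<lambda>i. grad i (st_u st) - grad i (st_phi st i)"
  have "estimator i st - gradF (st_u st)
      = ?X i - (1 / real (card {1..n})) *\<^sub>R sum ?X {1..n}" for i
    by (simp add: estimator_def gradF_def sum_subtractf scaleR_diff_right)
  then have "(\<Sum>i=1..n. (norm (gradF (st_u st) - estimator i st))\<^sup>2) \<le> (\<Sum>i=1..n. (norm (?X i))\<^sup>2)"
    using sum_sq_deviation_le[of ?X "{1..n}"] by (simp add: norm_minus_commute)
  also have "\<dots> \<le> (\<Sum>i=1..n. 2 * (norm (grad i (st_u st) - grad i xs))\<^sup>2
      + 2 * (norm (grad i (st_phi st i) - grad i xs))\<^sup>2)"
    by (intro sum_mono norm_diff_sq_le)
  finally have "(1 / real n) * (\<Sum>i=1..n. (norm (gradF (st_u st) - estimator i st))\<^sup>2)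
      \<le> (1 / real n) * (\<Sum>i=1..n. 2 * (norm (grad i (st_u st) - grad i xs))\<^sup>2
      + 2 * (norm (grad i (st_phi st i) - grad i xs))\<^sup>2)"
    by (intro mult_left_mono) auto
  also have "\<dots> = (1 / real n) * (2 * (\<Sum>i=1..n. (norm (grad i (st_u st) - grad i xs))\<^sup>2)
      + 2 * (\<Sum>i=1..n. (norm (grad i (st_phi st i) - grad i xs))\<^sup>2))"
    by (simp only: sum.distrib sum_distrib_left[symmetric])
  finally show ?thesis unfolding grad_error_def by (simp add: add_divide_distrib)
qed

lemma grad_error_update:
  assumes "i \<in> {1..n}"
  shows "grad_error (\<phi>(i := u)) = grad_error \<phi>
     + ((norm (grad i u - grad i xs))\<^sup>2 - (norm (grad i (\<phi> i) - grad i xs))\<^sup>2) / real n"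
proof -
  let ?h = "\<lambda>j y. (norm (grad j y - grad j xs))\<^sup>2"
  have aux: "(1 / real n) * (S + X) = (1 / real n) * S + X / real n" for S X :: real
    by (simp add: add_divide_distrib)
  have "(\<Sum>j=1..n. ?h j ((\<phi>(i := u)) j)) = (\<Sum>j=1..n. ?h j (\<phi> j)) + (?h i u - ?h i (\<phi> i))"
    by (rule sum_fun_upd) (use assms in auto)
  then have "grad_error (\<phi>(i := u)) = (1 / real n) * ((\<Sum>j=1..n. ?h j (\<phi> j)) + (?h i u - ?h i (\<phi> i)))"
    unfolding grad_error_def by (rule arg_cong)
  also have "\<dots> = grad_error \<phi> + (?h i u - ?h i (\<phi> i)) / real n"
    unfolding grad_error_def by (rule aux)
  finally show ?thesis .
qed

text \<open>
  Each entry is overwritten with probability \<open>1 / n\<close>.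
\<close>

lemma grad_error_update_average:
  "(1 / real n) * (\<Sum>i=1..n. grad_error (\<phi>(i := u)))
     = (1 - 1 / real n) * grad_error \<phi> + grad_error (\<lambda>_. u) / real n"
proof -
  have "(\<Sum>i=1..n. grad_error (\<phi>(i := u))) = (\<Sum>i=1..n. grad_error \<phi>
     + ((norm (grad i u - grad i xs))\<^sup>2 - (norm (grad i (\<phi> i) - grad i xs))\<^sup>2) / real n)"
    by (intro sum.cong refl grad_error_update)
  also have "\<dots> = (\<Sum>i=1..n. grad_error \<phi>) + ((\<Sum>i=1..n. (norm (grad i u - grad i xs))\<^sup>2)
      - (\<Sum>i=1..n. (norm (grad i (\<phi> i) - grad i xs))\<^sup>2)) / real n"
    by (simp only: sum.distrib sum_divide_distrib[symmetric] sum_subtractf)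
  also have "\<dots> = real n * grad_error \<phi> + (grad_error (\<lambda>_. u) - grad_error \<phi>)"
    by (simp add: grad_error_def diff_divide_distrib)
  finally have "(1 / real n) * (\<Sum>i=1..n. grad_error (\<phi>(i := u)))
      = (1 / real n) * (real n * grad_error \<phi> + (grad_error (\<lambda>_. u) - grad_error \<phi>))"
    by simp
  then show ?thesis using n by (simp add: field_simps)
qed

text \<open>
  The dual averaging model: since \<open>t\<close> times the averaged gradient is the sum of all estimators so far,
  this is the sum over the past iterations of the linearized \<open>F\<close> plus \<open>R\<close>, together with the proximal
  term around \<open>v\<^sub>0\<close>.  It is \<open>t\<close> times the function minimized in the definition of \<open>v\<^sub>t\<close>; in this scaling
  one iteration adds a single summand, and \<open>t = 0\<close> makes sense.
\<close>

definition psi :: "fseq \<Rightarrow> nat \<Rightarrow> inner_state \<Rightarrow> fseq \<Rightarrow> real" where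
  "psi v0 t st y = real t * inner (st_gbar st) y + real t * R y + 5 * L / 2 * (norm (y - v0))\<^sup>2"

lemma psi_strongly_convex: "strongly_convex_on V (5 * L + real t * \<mu>) (psi v0 t st)"
proof -
  have "strongly_convex_on V (0 + real t * \<mu> + 5 * L)
      (\<lambda>y. inner (real t *\<^sub>R st_gbar st) y + real t * R y + 5 * L / 2 * (norm (y - v0))\<^sup>2)"
    by (intro strongly_convex_on_add strongly_convex_on_inner strongly_convex_on_norm_sq
        strongly_convex_on_scale R_strongly_convex) simp
  then show ?thesis by (simp add: psi_def[abs_def] add.commute)
qed

text \<open>
  At \<open>t = 0\<close> the equation for \<open>u\<close> reads \<open>u = v\<close> and the minimality of \<open>v\<close> reads \<open>v = v\<^sub>0\<close>, so the initial
  state is covered.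
\<close>

definition inner_inv :: "fseq \<Rightarrow> nat \<Rightarrow> inner_state \<Rightarrow> bool" where
  "inner_inv v0 t st \<longleftrightarrow> st_x st \<in> V \<and> st_v st \<in> V \<and> st_gbar st \<in> V \<and> (\<forall>j\<in>{1..n}. st_phi st j \<in> V)
     \<and> st_u st = (1 - 1 / (real t + 1)) *\<^sub>R st_x st + (1 / (real t + 1)) *\<^sub>R st_v st
     \<and> (\<forall>y\<in>V. psi v0 t st (st_v st) \<le> psi v0 t st y)"

lemma inner_inv_u_in: "inner_inv v0 t st \<Longrightarrow> st_u st \<in> V"
  unfolding inner_inv_def by (auto intro!: V_intros)

lemma inner_inv_growth:
  assumes "inner_inv v0 t st" "y \<in> V"
  shows "psi v0 t st (st_v st) + (5 * L + real t * \<mu>) / 2 * (norm (y - st_v st))\<^sup>2 \<le> psi v0 t st y"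
  by (rule strongly_convex_on_minimum_growth[OF psi_strongly_convex subspace_rspace _ _ assms(2)])
    (use assms(1) in \<open>auto simp: inner_inv_def\<close>)

lemma inner_inv_init:
  assumes "x0 \<in> V" "v0 \<in> V"
  shows "inner_inv v0 0 \<lparr>st_x = x0, st_v = v0, st_u = v0, st_gbar = 0, st_phi = (\<lambda>_. x0)\<rparr>"
  using assms L by (auto simp: inner_inv_def psi_def intro: V_intros)

lemma estimator_in:
  assumes "inner_inv v0 t st" "i \<in> {1..n}"
  shows "estimator i st \<in> V"
  unfolding estimator_def
  by (intro V_intros grad_in inner_inv_u_in[OF assms(1)])
    (use assms in \<open>auto simp: inner_inv_def\<close>)

context
  fixes v0 :: fseq and t i :: nat and st st' :: inner_state
  assumes inv: "inner_inv v0 t st" and i: "i \<in> {1..n}"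
    and st': "st' = sada_step d n f R (5 * L) v0 (Suc t) i st"
begin

abbreviation "T \<equiv> real (Suc t)"

lemma step_phi: "st_phi st' = (st_phi st)(i := st_u st)"
  by (simp add: st' sada_step_def Let_def)

lemma step_gbar: "st_gbar st' = (1 - 1 / T) *\<^sub>R st_gbar st + (1 / T) *\<^sub>R estimator i st"
  by (simp add: st' sada_step_def Let_def estimator_def grad_def)

lemma step_v: "st_v st' = arg_min_on (\<lambda>x. inner (st_gbar st') x + R x
    + 5 * L / (2 * T) * (norm (x - v0))\<^sup>2) V"
  by (simp add: st' sada_step_def Let_def)

lemma step_x: "st_x st' = arg_min_on (\<lambda>x. inner (estimator i st) x + R x
    + 5 * L * T / 2 * (norm (x - st_u st))\<^sup>2) V"
  by (simp add: st' sada_step_def Let_def estimator_def grad_def)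

lemma step_u: "st_u st' = (1 - 1 / (T + 1)) *\<^sub>R st_x st' + (1 / (T + 1)) *\<^sub>R st_v st'"
  by (simp add: st' sada_step_def Let_def)

lemma step_x_minimizes:
  shows "st_x st' \<in> V"
    and "y \<in> V \<Longrightarrow> inner (estimator i st) (st_x st') + R (st_x st')
           + 5 * L * T / 2 * (norm (st_x st' - st_u st))\<^sup>2
         \<le> inner (estimator i st) y + R y + 5 * L * T / 2 * (norm (y - st_u st))\<^sup>2"
proof -
  let ?h = "\<lambda>x. inner (estimator i st) x + R x + 5 * L * T / 2 * (norm (x - st_u st))\<^sup>2"
  have sc: "strongly_convex_on V (0 + \<mu> + 5 * L * T) ?h"
    by (intro strongly_convex_on_add strongly_convex_on_inner strongly_convex_on_norm_sq
        R_strongly_convex)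
  have pos: "0 < 0 + \<mu> + 5 * L * T" using \<mu> L by (simp add: add_pos_nonneg)
  show "st_x st' \<in> V" unfolding step_x by (rule arg_min_on_rspace(1)[OF sc pos])
  assume y: "y \<in> V"
  have "0 \<le> (0 + \<mu> + 5 * L * T) / 2 * (norm (y - arg_min_on ?h V))\<^sup>2" using pos by simp
  then show "?h (st_x st') \<le> ?h y"
    using arg_min_on_rspace(2)[OF sc pos y] unfolding step_x by linarith
qed

lemma step_psi: "psi v0 (Suc t) st' y = psi v0 t st y + inner (estimator i st) y + R y"
proof -
  have "T *\<^sub>R st_gbar st' = real t *\<^sub>R st_gbar st + estimator i st"
    unfolding step_gbar by (simp add: scaleR_add_right right_diff_distrib)
  then have "T * inner (st_gbar st') y = real t * inner (st_gbar st) y + inner (estimator i st) y"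
    by (metis inner_add_left inner_scaleR_left)
  then show ?thesis unfolding psi_def by (simp add: algebra_simps)
qed

lemma step_inner_inv: "inner_inv v0 (Suc t) st'"
proof -
  let ?h = "\<lambda>x. inner (st_gbar st') x + R x + 5 * L / (2 * T) * (norm (x - v0))\<^sup>2"
  have sc: "strongly_convex_on V (0 + \<mu> + 5 * L / T) ?h"
    using strongly_convex_on_add[OF strongly_convex_on_add[OF
          strongly_convex_on_inner[of V "st_gbar st'"] R_strongly_convex]
        strongly_convex_on_norm_sq[of V "5 * L / T" v0]]
    by (simp add: mult.commute)
  have pos: "0 < 0 + \<mu> + 5 * L / T" using \<mu> L by (simp add: add_pos_nonneg)
  have vV: "st_v st' \<in> V" unfolding step_v by (rule arg_min_on_rspace(1)[OF sc pos])
  have psi: "psi v0 (Suc t) st' y = T * ?h y" for y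
    unfolding psi_def by (simp add: distrib_left field_simps)
  have "psi v0 (Suc t) st' (st_v st') \<le> psi v0 (Suc t) st' y" if y: "y \<in> V" for y
  proof -
    have "0 \<le> (0 + \<mu> + 5 * L / T) / 2 * (norm (y - arg_min_on ?h V))\<^sup>2" using pos by simp
    then have "?h (st_v st') \<le> ?h y"
      using arg_min_on_rspace(2)[OF sc pos y] unfolding step_v by linarith
    then show ?thesis unfolding psi by (intro mult_left_mono) auto
  qed
  moreover have "st_gbar st' \<in> V"
    unfolding step_gbar
    by (intro V_intros estimator_in[OF inv i]) (use inv in \<open>simp add: inner_inv_def\<close>)
  ultimately show ?thesis
    using inv vV step_x_minimizes(1) step_u inner_inv_u_in[OF inv]
    unfolding inner_inv_def step_phi by auto
qed

text \<open>
  The bound that holds for every draw.  The new point \<open>x'\<close> is compared with the average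
  \<open>y = (1 - 1 / T) x + (1 / T) v'\<close>, which is admissible in the minimization defining \<open>x'\<close>.  Since
  \<open>u = (1 - 1 / T) x + (1 / T) v\<close>, the two averages differ by \<open>(v' - v) / T\<close>; after multiplication by
  \<open>T\<close> the proximal term at \<open>y\<close> is therefore at most the amount by which the model \<open>psi\<close> grows from its
  minimizer \<open>v\<close> to \<open>v'\<close>.  Young's inequality splits the product of the estimator's error with the step
  \<open>x' - u\<close>; the proximal term absorbs the square of the step, and the square of the error remains.
\<close>

lemma step_progress:
  "T * P (st_x st') + (psi v0 (Suc t) st' xs - psi v0 (Suc t) st' (st_v st'))
     \<le> (psi v0 t st xs - psi v0 t st (st_v st)) + real t * R (st_x st) + T * F (st_u st) + R xs
        + inner (estimator i st) (real t *\<^sub>R (st_x st - st_u st) + (xs - st_u st))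
        + (norm (gradF (st_u st) - estimator i st))\<^sup>2 / (8 * L)"
proof -
  define x v u g x' v' where "x = st_x st" and "v = st_v st" and "u = st_u st"
    and "g = estimator i st" and "x' = st_x st'" and "v' = st_v st'"
  note defs = x_def v_def u_def g_def x'_def v'_def
  have inV: "x \<in> V" "v \<in> V" "u \<in> V" "x' \<in> V" "v' \<in> V"
    using inv step_inner_inv inner_inv_u_in[OF inv] unfolding defs inner_inv_def by auto
  have T: "0 < T" "1 \<le> T" by simp_all
  define y where "y = (1 - 1 / T) *\<^sub>R x + (1 / T) *\<^sub>R v'"
  have y: "y \<in> V" unfolding y_def by (intro V_intros inV)
  have Ty: "T *\<^sub>R y = real t *\<^sub>R x + v'"
    unfolding y_def by (simp add: scaleR_add_right right_diff_distrib)
  have Tu: "T *\<^sub>R u = real t *\<^sub>R x + v"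
  proof -
    have "u = (1 - 1 / T) *\<^sub>R x + (1 / T) *\<^sub>R v"
      using inv unfolding inner_inv_def defs by (simp add: add.commute)
    then show ?thesis by (simp add: scaleR_add_right right_diff_distrib)
  qed
  have yu: "T\<^sup>2 * (norm (y - u))\<^sup>2 = (norm (v' - v))\<^sup>2"
  proof -
    have "T *\<^sub>R (y - u) = v' - v" using Ty Tu by (simp add: scaleR_diff_right)
    then have "(norm (T *\<^sub>R (y - u)))\<^sup>2 = (norm (v' - v))\<^sup>2" by simp
    then show ?thesis by (simp add: power_mult_distrib)
  qed
  have 1: "F x' \<le> F u + inner (gradF u) (x' - u) + L / 2 * (norm (x' - u))\<^sup>2"
    by (intro F_descent inV)
  \<comment> \<open>The parameter \<open>4 T L\<close> is what the proximal weight \<open>5 L T\<close> leaves after the descent lemma has used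
    \<open>L \<le> T L\<close>.\<close>
  have 2: "inner (gradF u - g) (x' - u)
      \<le> (norm (gradF u - g))\<^sup>2 / (2 * (4 * T * L)) + 4 * T * L / 2 * (norm (x' - u))\<^sup>2"
    using T L by (intro inner_le_Young) simp
  have 3: "inner g x' + R x' + 5 * L * T / 2 * (norm (x' - u))\<^sup>2
      \<le> inner g y + R y + 5 * L * T / 2 * (norm (y - u))\<^sup>2"
    using step_x_minimizes(2)[OF y] unfolding defs .
  have 4: "L / 2 * (norm (x' - u))\<^sup>2 + 4 * T * L / 2 * (norm (x' - u))\<^sup>2
      \<le> 5 * L * T / 2 * (norm (x' - u))\<^sup>2"
  proof -
    have "L / 2 + 4 * T * L / 2 \<le> 5 * L * T / 2" using L T(2) by (simp add: field_simps)
    from mult_right_mono[OF this, of "(norm (x' - u))\<^sup>2"] show ?thesis by (simp add: distrib_right)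
  qed
  have "P x' \<le> F u + inner g (y - u) + R y + 5 * L * T / 2 * (norm (y - u))\<^sup>2
      + (norm (gradF u - g))\<^sup>2 / (2 * (4 * T * L))"
    using 1 2 3 4 unfolding P_eq inner_diff_left inner_diff_right by linarith
  then have "T * P x' \<le> T * (F u + inner g (y - u) + R y + 5 * L * T / 2 * (norm (y - u))\<^sup>2
      + (norm (gradF u - g))\<^sup>2 / (2 * (4 * T * L)))"
    using T by (intro mult_left_mono) auto
  also have "\<dots> = T * F u + (inner g (T *\<^sub>R y) - inner g (T *\<^sub>R u)) + T * R y
      + 5 * L / 2 * (T\<^sup>2 * (norm (y - u))\<^sup>2) + (norm (gradF u - g))\<^sup>2 / (8 * L)"
  proof -
    have a': "\<tau> * (5 * l * \<tau> / 2 * q) = 5 * l / 2 * (\<tau>\<^sup>2 * q)" for \<tau> l q :: real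
      by (simp add: power2_eq_square)
    have b': "\<tau> * (q / (2 * (4 * \<tau> * l))) = q / (8 * l)" if "0 < \<tau>" for \<tau> l q :: real
      using that by simp
    have a: "T * (5 * L * T / 2 * (norm (y - u))\<^sup>2) = 5 * L / 2 * (T\<^sup>2 * (norm (y - u))\<^sup>2)"
      by (rule a')
    have b: "T * ((norm (gradF u - g))\<^sup>2 / (2 * (4 * T * L))) = (norm (gradF u - g))\<^sup>2 / (8 * L)"
      by (rule b'[OF T(1)])
    have c: "T * inner g (y - u) = inner g (T *\<^sub>R y) - inner g (T *\<^sub>R u)"
      by (simp only: inner_diff_right inner_scaleR_right right_diff_distrib)
    show ?thesis by (simp only: distrib_left a b c)
  qed
  also have "\<dots> = T * F u + inner g (real t *\<^sub>R x + v' - T *\<^sub>R u) + T * R y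
      + 5 * L / 2 * (norm (v' - v))\<^sup>2 + (norm (gradF u - g))\<^sup>2 / (8 * L)"
    unfolding yu Ty by (simp only: inner_diff_right)
  finally have 5: "T * P x' \<le> \<dots>" .
  have 6: "T * R y \<le> real t * R x + R v'"
  proof -
    have "R y \<le> (1 - 1 / T) * R x + (1 / T) * R v'"
      unfolding y_def using convex_onD[OF convR, of "1 / T" x v'] inV by simp
    then have "T * R y \<le> T * ((1 - 1 / T) * R x + (1 / T) * R v')"
      using T by (intro mult_left_mono) auto
    also have "\<dots> = real t * R x + R v'"
      by (simp add: distrib_left mult.assoc[symmetric] right_diff_distrib)
    finally show ?thesis .
  qed
  have 7: "psi v0 t st v + 5 * L / 2 * (norm (v' - v))\<^sup>2 \<le> psi v0 t st v'"
  proof -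
    have "5 * L / 2 * (norm (v' - v))\<^sup>2 \<le> (5 * L + real t * \<mu>) / 2 * (norm (v' - v))\<^sup>2"
      using \<mu> by (intro mult_right_mono) auto
    then show ?thesis using inner_inv_growth[OF inv inV(5)] unfolding v_def by linarith
  qed
  have 8: "inner g (real t *\<^sub>R x + v' - T *\<^sub>R u) + inner g xs - inner g v'
      = inner g (real t *\<^sub>R (x - u) + (xs - u))"
  proof -
    have "T *\<^sub>R u = real t *\<^sub>R u + u" by (simp add: scaleR_left_distrib)
    then show ?thesis
      by (simp only: inner_add_right inner_diff_right inner_scaleR_right right_diff_distrib)
  qed
  have sum_up: "a + (sx - sv) \<le> (px - p) + c + b + rx + I + e"
    if "a \<le> b + q + r + h + e" "r \<le> c + w" "p + h \<le> p'" "q + gx - gv = I"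
      "sx = px + gx + rx" "sv = p' + gv + w"
    for a b c e h p p' px q r rx sx sv gx gv w I :: real
    using that by linarith
  show ?thesis
    using sum_up[OF 5 6 7 8 step_psi[of xs, folded g_def] step_psi[of v', folded g_def]]
    unfolding defs .
qed

end

end


section \<open>One stage\<close>

lemma expectation_mono_finite:
  fixes h k :: "'a \<Rightarrow> real"
  assumes "finite (set_pmf p)" "\<And>x. x \<in> set_pmf p \<Longrightarrow> h x \<le> k x"
  shows "measure_pmf.expectation p h \<le> measure_pmf.expectation p k"
proof -
  have "measure_pmf.expectation p g = (\<Sum>a\<in>set_pmf p. pmf p a *\<^sub>R g a)" for g :: "'a \<Rightarrow> real"
    by (rule integral_measure_pmf[OF assms(1)])
  then show ?thesis
    using assms(2) by (auto intro!: sum_mono mult_left_mono)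
qed

text \<open>
  The tower rule for laws of finite support, in the form of a supermartingale step.
\<close>

lemma expectation_bind_le:
  fixes h :: "'b \<Rightarrow> real"
  assumes p: "finite (set_pmf p)" and q: "\<And>x. x \<in> set_pmf p \<Longrightarrow> finite (set_pmf (q x))"
    and le: "\<And>x. x \<in> set_pmf p \<Longrightarrow> measure_pmf.expectation (q x) h \<le> k x"
  shows "measure_pmf.expectation (bind_pmf p q) h \<le> measure_pmf.expectation p k"
proof -
  have "measure_pmf.expectation (bind_pmf p q) h
      = (\<Sum>a\<in>set_pmf p. pmf p a *\<^sub>R measure_pmf.expectation (q a) h)"
    by (rule pmf_expectation_bind[OF p q order_refl])
  also have "\<dots> = measure_pmf.expectation p (\<lambda>a. measure_pmf.expectation (q a) h)"
    by (rule integral_measure_pmf[OF p, symmetric]) simp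
  also have "\<dots> \<le> measure_pmf.expectation p k"
    by (rule expectation_mono_finite[OF p le])
  finally show ?thesis .
qed

context sada_problem
begin

text \<open>
  The quantity that decreases in expectation along a stage: the weighted optimality gap, the excess of
  the dual averaging model at the solution over its minimum, and the error of the gradient table.
\<close>

definition potential :: "real \<Rightarrow> fseq \<Rightarrow> nat \<Rightarrow> inner_state \<Rightarrow> real" where
  "potential c v0 t st = real t * (P (st_x st) - P xs)
     + (psi v0 t st xs - psi v0 t st (st_v st)) + c * grad_error (st_phi st)"

text \<open>
  Averaging the bound for single draws replaces the estimator by the gradient of \<open>F\<close>, so convexity
  turns the linear terms at \<open>x\<close> and at the solution into function values.  The gradient distance
  \<open>B / (2 L)\<close> gained at the solution pays twice \<open>B / (4 L)\<close>: once in the variance and once for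
  writing the gradients at \<open>u\<close> into the table.
\<close>

lemma potential_decrease:
  assumes inv: "inner_inv v0 t st"
    and c': "0 \<le> c'" "c' \<le> real n / (4 * L)" "c' * (1 - 1 / real n) + 1 / (4 * L) \<le> c"
  shows "(1 / real n) * (\<Sum>i=1..n. potential c' v0 (Suc t) (sada_step d n f R (5 * L) v0 (Suc t) i st))
           \<le> potential c v0 t st"
proof -
  define x u where "x = st_x st" and "u = st_u st"
  define T where "T = real (Suc t)"
  define A B where "A = grad_error (st_phi st)" and "B = grad_error (\<lambda>_. u)"
  define W where "W = psi v0 t st xs - psi v0 t st (st_v st)"
  define w where "w = real t *\<^sub>R (x - u) + (xs - u)"
  define K where "K = W + real t * R x + T * F u + R xs - T * P xs"
  let ?p = "\<lambda>i. inner (estimator i st) w"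
  let ?q = "\<lambda>i. (norm (gradF u - estimator i st))\<^sup>2"
  let ?r = "\<lambda>i. grad_error ((st_phi st)(i := u))"
  let ?avg = "\<lambda>h :: nat \<Rightarrow> real. (1 / real n) * (\<Sum>i=1..n. h i)"
  have xV: "x \<in> V" and uV: "u \<in> V"
    using inv inner_inv_u_in[OF inv] unfolding x_def u_def inner_inv_def by auto
  have AB: "0 \<le> A" "0 \<le> B" unfolding A_def B_def by (simp_all add: grad_error_nonneg)
  have "?avg (\<lambda>i. potential c' v0 (Suc t) (sada_step d n f R (5 * L) v0 (Suc t) i st))
      \<le> ?avg (\<lambda>i. K + ?p i + ?q i / (8 * L) + c' * ?r i)"
  proof (rule average_le)
    fix i assume i: "i \<in> {1..n}"
    show "potential c' v0 (Suc t) (sada_step d n f R (5 * L) v0 (Suc t) i st)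
        \<le> K + ?p i + ?q i / (8 * L) + c' * ?r i"
      using step_progress[OF inv i refl]
      unfolding potential_def step_phi[OF inv i refl] K_def W_def w_def x_def u_def T_def right_diff_distrib
      by linarith
  qed
  also have "\<dots> = K + ?avg ?p + ?avg ?q / (8 * L) + c' * ?avg ?r"
  proof -
    have "(\<Sum>i=1..n. K + ?p i + ?q i / (8 * L) + c' * ?r i) = (\<Sum>i=1..n. K)
        + (\<Sum>i=1..n. ?p i) + (\<Sum>i=1..n. ?q i) / (8 * L) + c' * (\<Sum>i=1..n. ?r i)"
      by (simp only: sum.distrib sum_distrib_left sum_divide_distrib)
    moreover have "(1 / real n) * (k + p + q / l + c' * r)
        = (1 / real n) * k + (1 / real n) * p + (1 / real n) * q / l + c' * ((1 / real n) * r)"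
      for k p q r l :: real
      by (simp add: distrib_left add_divide_distrib)
    ultimately show ?thesis by (simp only: average_const)
  qed
  also have "\<dots> = K + inner (gradF u) w + ?avg ?q / (8 * L) + c' * ((1 - 1 / real n) * A + B / real n)"
    unfolding u_def estimator_unbiased grad_error_update_average A_def B_def ..
  also have "\<dots> \<le> potential c v0 t st"
  proof -
    have 1: "real t * (F u + inner (gradF u) (x - u)) \<le> real t * F x"
      by (intro mult_left_mono F_above_tangent uV xV) simp
    have 2: "F u + inner (gradF u) (xs - u) + B / (2 * L) \<le> F xs"
      using F_gradient_gap[OF uV xs_in] unfolding B_def grad_error_def by (simp only: norm_minus_commute)
    have 3: "?avg ?q / (8 * L) \<le> B / (4 * L) + A / (4 * L)"
    proof -
      have "?avg ?q \<le> 2 * B + 2 * A"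
        using estimator_variance[of st] unfolding u_def A_def B_def .
      then have "?avg ?q / (8 * L) \<le> (2 * B + 2 * A) / (8 * L)"
        using L by (intro divide_right_mono) auto
      then show ?thesis by (simp add: add_divide_distrib)
    qed
    have 4: "c' * (B / real n) \<le> B / (4 * L)"
    proof -
      have "c' * (B / real n) \<le> (real n / (4 * L)) * (B / real n)"
        using c' AB by (intro mult_right_mono) auto
      then show ?thesis using n by simp
    qed
    have 5: "c' * ((1 - 1 / real n) * A) + A / (4 * L) \<le> c * A"
      using mult_right_mono[OF c'(3) AB(1)] by (simp add: distrib_right mult.assoc)
    have 6: "B / (2 * L) = B / (4 * L) + B / (4 * L)" by simp
    have 7: "inner (gradF u) w = real t * inner (gradF u) (x - u) + inner (gradF u) (xs - u)"
      unfolding w_def by (simp add: inner_add_right)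
    have 8: "T * F u = real t * F u + F u" "T * P xs = real t * P xs + F xs + R xs"
      unfolding T_def P_eq by (simp_all add: algebra_simps)
    have 9: "potential c v0 t st = real t * F x + real t * R x - real t * P xs + W + c * A"
      unfolding potential_def x_def W_def A_def P_eq by (simp add: algebra_simps)
    show ?thesis
      using 1 2 3 4 5 6 unfolding K_def 7 8 9 distrib_left by linarith
  qed
  finally show ?thesis .
qed

text \<open>
  Each weight of the table error must be at least \<open>1 / (4 L)\<close>, the variance contribution, plus the next
  weight times \<open>1 - 1 / n\<close>, the decay of the table; and no weight used after an update may exceed
  \<open>n / (4 L)\<close>.  Counting the
  remaining iterations, capped at \<open>n\<close>, achieves this.  The weight vanishes at the end of the stage and
  starts at no more than \<open>m / (4 L)\<close>, so the initial table error costs an amount proportional to \<open>m\<close>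
  even when \<open>m\<close> is much smaller than \<open>n\<close>.
\<close>

definition error_weight :: "nat \<Rightarrow> nat \<Rightarrow> real" where
  "error_weight m t = real (min (m - t) n) / (4 * L)"

lemma error_weight_bounds:
  assumes "Suc t \<le> m"
  shows "0 \<le> error_weight m (Suc t)" "error_weight m (Suc t) \<le> real n / (4 * L)"
    and "error_weight m (Suc t) * (1 - 1 / real n) + 1 / (4 * L) \<le> error_weight m t"
proof -
  show "0 \<le> error_weight m (Suc t)" "error_weight m (Suc t) \<le> real n / (4 * L)"
    using L by (auto simp: error_weight_def intro!: divide_right_mono)
  let ?k = "min (m - Suc t) n"
  have "real ?k * (1 - 1 / real n) + 1 \<le> real (min (m - t) n)"
  proof (cases "m - t \<le> n")
    case True
    then have "real (min (m - t) n) = real ?k + 1" using assms by auto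
    moreover have "real ?k * (1 - 1 / real n) \<le> real ?k" by (simp add: mult_left_le)
    ultimately show ?thesis by linarith
  next
    case False
    then have k: "?k = n" and k': "min (m - t) n = n" by auto
    show ?thesis unfolding k k' using n by (simp add: right_diff_distrib)
  qed
  then have "(real ?k * (1 - 1 / real n) + 1) / (4 * L) \<le> real (min (m - t) n) / (4 * L)"
    using L by (intro divide_right_mono) auto
  then show "error_weight m (Suc t) * (1 - 1 / real n) + 1 / (4 * L) \<le> error_weight m t"
    by (simp add: error_weight_def add_divide_distrib)
qed

lemma set_pmf_draw: "set_pmf (pmf_of_set {Suc 0..n}) = {Suc 0..n}"
  using n by (intro set_pmf_of_set) auto

lemma finite_sada_inner: "finite (set_pmf (sada_inner d n f R \<eta> x0 v0 t))"
  by (induction t) (auto simp: set_pmf_draw)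

lemma sada_inner_inv:
  assumes "x0 \<in> V" "v0 \<in> V" "st \<in> set_pmf (sada_inner d n f R (5 * L) x0 v0 t)"
  shows "inner_inv v0 t st"
  using assms(3)
proof (induction t arbitrary: st)
  case 0 then show ?case using inner_inv_init[OF assms(1,2)] by simp
next
  case (Suc t)
  then show ?case using step_inner_inv by (auto simp: set_pmf_draw)
qed

lemma sada_inner_potential:
  assumes x0: "x0 \<in> V" and v0: "v0 \<in> V" and t: "t \<le> m"
  shows "measure_pmf.expectation (sada_inner d n f R (5 * L) x0 v0 t) (potential (error_weight m t) v0 t)
     \<le> 5 * L / 2 * (norm (xs - v0))\<^sup>2 + error_weight m 0 * grad_error (\<lambda>_. x0)"
  using t
proof (induction t)
  case 0
  then show ?case by (simp add: potential_def psi_def)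
next
  case (Suc t)
  let ?h = "potential (error_weight m (Suc t)) v0 (Suc t)"
  have "measure_pmf.expectation (sada_inner d n f R (5 * L) x0 v0 (Suc t)) ?h
      \<le> measure_pmf.expectation (sada_inner d n f R (5 * L) x0 v0 t) (potential (error_weight m t) v0 t)"
    unfolding sada_inner.simps
  proof (rule expectation_bind_le[OF finite_sada_inner])
    fix st assume "st \<in> set_pmf (sada_inner d n f R (5 * L) x0 v0 t)"
    then have inv: "inner_inv v0 t st" by (rule sada_inner_inv[OF x0 v0])
    let ?q = "pmf_of_set {1..n} \<bind> (\<lambda>i. return_pmf (sada_step d n f R (5 * L) v0 (Suc t) i st))"
    show "finite (set_pmf ?q)" by (simp add: set_pmf_draw)
    have "measure_pmf.expectation ?q ?h
        = (1 / real n) * (\<Sum>i=1..n. ?h (sada_step d n f R (5 * L) v0 (Suc t) i st))"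
      using n by (subst pmf_expectation_bind_pmf_of_set)
        (auto simp: sum_distrib_left divide_inverse)
    also have "\<dots> \<le> potential (error_weight m t) v0 t st"
      by (rule potential_decrease[OF inv error_weight_bounds[OF Suc.prems]])
    finally show "measure_pmf.expectation ?q ?h \<le> potential (error_weight m t) v0 t st" .
  qed
  also have "\<dots> \<le> 5 * L / 2 * (norm (xs - v0))\<^sup>2 + error_weight m 0 * grad_error (\<lambda>_. x0)"
    using Suc by simp
  finally show ?case .
qed

text \<open>
  At the end of the stage the model excess dominates the squared distance of \<open>v\<close> with weight
  \<open>(5 L + m \<mu>) / 2\<close>, by the growth of \<open>psi\<close> at its minimizer.  At the start it equals the proximal term,
  and the table error is bounded by the optimality gap.
\<close>

lemma sada_inner_bound:
  assumes x0: "x0 \<in> V" and v0: "v0 \<in> V"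
  shows "measure_pmf.expectation (sada_inner d n f R (5 * L) x0 v0 m)
        (\<lambda>st. real m * (P (st_x st) - P xs) + (5 * L + real m * \<mu>) / 2 * (norm (st_v st - xs))\<^sup>2)
     \<le> 5 * L / 2 * (norm (v0 - xs))\<^sup>2 + real m / 2 * (P x0 - P xs - \<mu> / 2 * (norm (x0 - xs))\<^sup>2)"
proof -
  have "measure_pmf.expectation (sada_inner d n f R (5 * L) x0 v0 m)
        (\<lambda>st. real m * (P (st_x st) - P xs) + (5 * L + real m * \<mu>) / 2 * (norm (st_v st - xs))\<^sup>2)
      \<le> measure_pmf.expectation (sada_inner d n f R (5 * L) x0 v0 m) (potential (error_weight m m) v0 m)"
  proof (rule expectation_mono_finite[OF finite_sada_inner])
    fix st assume "st \<in> set_pmf (sada_inner d n f R (5 * L) x0 v0 m)"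
    from inner_inv_growth[OF sada_inner_inv[OF x0 v0 this] xs_in]
    show "real m * (P (st_x st) - P xs) + (5 * L + real m * \<mu>) / 2 * (norm (st_v st - xs))\<^sup>2
        \<le> potential (error_weight m m) v0 m st"
      unfolding potential_def norm_minus_commute[of "st_v st" xs] by (simp add: error_weight_def)
  qed
  also have "\<dots> \<le> 5 * L / 2 * (norm (xs - v0))\<^sup>2 + error_weight m 0 * grad_error (\<lambda>_. x0)"
    by (rule sada_inner_potential[OF x0 v0 order_refl])
  also have "error_weight m 0 * grad_error (\<lambda>_. x0)
      \<le> real m / (4 * L) * (2 * L * (P x0 - P xs - \<mu> / 2 * (norm (x0 - xs))\<^sup>2))"
    using L grad_error_nonneg grad_error_const_le[OF x0]
    by (intro mult_mono) (auto simp: error_weight_def intro!: divide_right_mono)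
  also have "\<dots> = real m / 2 * (P x0 - P xs - \<mu> / 2 * (norm (x0 - xs))\<^sup>2)"
  proof -
    have "real m / (4 * L) * (2 * L * X) = real m / 2 * X" for X using L by (simp add: field_simps)
    then show ?thesis .
  qed
  finally show ?thesis by (simp only: norm_minus_commute)
qed


section \<open>Contraction over the stages\<close>

text \<open>
  The Lyapunov function of the outer iteration.
\<close>

definition gap :: "fseq \<times> fseq \<Rightarrow> real" where
  "gap = (\<lambda>(x, v). P x - P xs + 3 * \<mu> / 2 * (norm (v - xs))\<^sup>2)"

text \<open>
  With \<open>5 L = 2 m \<mu>\<close> the stage bound, divided by \<open>m\<close>, has weight \<open>3 \<mu> / 2\<close> on the final distance and \<open>\<mu>\<close>
  on the initial one.  Splitting the distance of \<open>v\<^sub>0\<close> with weights \<open>3 / 4\<close> and \<open>1 / 4\<close> leaves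
  \<open>3 \<mu> / 4\<close>, half the weight, on the outer \<open>v\<close>, while the term \<open>\<mu> / 4\<close> of the outer \<open>x\<close> cancels against
  the strong convexity term of the table error.
\<close>

lemma stage_halves_gap:
  assumes x: "x \<in> V" and v: "v \<in> V" and m: "1 \<le> m" "real m = 5 * L / (2 * \<mu>)"
  shows "measure_pmf.expectation
      (sada_inner d n f R (5 * L) x ((1 - 1 / 4) *\<^sub>R v + (1 / 4) *\<^sub>R x) m) (\<lambda>st. gap (st_x st, st_v st))
    \<le> 1 / 2 * gap (x, v)"
proof -
  let ?v0 = "(1 - 1 / 4) *\<^sub>R v + (1 / 4) *\<^sub>R x"
  let ?E = "measure_pmf.expectation (sada_inner d n f R (5 * L) x ?v0 m)"
  have v0: "?v0 \<in> V" by (intro V_intros x v)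
  have mL: "5 * L = 2 * (real m * \<mu>)" using m \<mu> by (simp add: field_simps)
  have eq: "real m * (P (st_x st) - P xs) + (5 * L + real m * \<mu>) / 2 * (norm (st_v st - xs))\<^sup>2
      = real m * gap (st_x st, st_v st)" for st
    unfolding mL gap_def by (simp add: algebra_simps)
  have "real m * ?E (\<lambda>st. gap (st_x st, st_v st))
      \<le> 5 * L / 2 * (norm (?v0 - xs))\<^sup>2 + real m / 2 * (P x - P xs - \<mu> / 2 * (norm (x - xs))\<^sup>2)"
    using sada_inner_bound[OF x v0, of m] unfolding eq by simp
  also have "5 * L / 2 * (norm (?v0 - xs))\<^sup>2
      \<le> 5 * L / 2 * (3 / 4 * (norm (v - xs))\<^sup>2 + 1 / 4 * (norm (x - xs))\<^sup>2)"
    unfolding norm_convex_combination_sq using L by (intro mult_left_mono) auto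
  also have "5 * L / 2 * (3 / 4 * (norm (v - xs))\<^sup>2 + 1 / 4 * (norm (x - xs))\<^sup>2)
      + real m / 2 * (P x - P xs - \<mu> / 2 * (norm (x - xs))\<^sup>2) = real m * (1 / 2 * gap (x, v))"
    unfolding mL gap_def by (simp add: algebra_simps)
  finally show ?thesis using m(1) by (simp only: mult_le_cancel_left_pos of_nat_0_less_iff)
qed

lemma finite_sada: "finite (set_pmf (sada d n f R \<eta> \<alpha> m xinit S))"
  by (induction S) (auto simp: finite_sada_inner split: prod.splits)

lemma sada_in:
  assumes "xinit \<in> V"
  shows "z \<in> set_pmf (sada d n f R (5 * L) \<alpha> m xinit S) \<Longrightarrow> fst z \<in> V \<and> snd z \<in> V"
proof (induction S arbitrary: z)
  case 0 then show ?case using assms by simp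
next
  case (Suc S)
  then obtain x v st where xv: "(x, v) \<in> set_pmf (sada d n f R (5 * L) \<alpha> m xinit S)"
    and st: "st \<in> set_pmf (sada_inner d n f R (5 * L) x ((1 - \<alpha>) *\<^sub>R v + \<alpha> *\<^sub>R x) m)"
    and z: "z = (st_x st, st_v st)"
    by auto
  have V: "x \<in> V" "v \<in> V" using Suc.IH[OF xv] by auto
  then have "(1 - \<alpha>) *\<^sub>R v + \<alpha> *\<^sub>R x \<in> V" by (intro V_intros)
  from sada_inner_inv[OF V(1) this st] show ?case unfolding z inner_inv_def by simp
qed

lemma sada_gap:
  assumes xinit: "xinit \<in> V" and m: "1 \<le> m" "real m = 5 * L / (2 * \<mu>)"
  shows "measure_pmf.expectation (sada d n f R (5 * L) (1 / 4) m xinit S) gap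
     \<le> 1 / 2 ^ S * gap (xinit, xinit)"
proof (induction S)
  case 0 then show ?case by simp
next
  case (Suc S)
  have "measure_pmf.expectation (sada d n f R (5 * L) (1 / 4) m xinit (Suc S)) gap
      \<le> measure_pmf.expectation (sada d n f R (5 * L) (1 / 4) m xinit S) (\<lambda>z. 1 / 2 * gap z)"
    unfolding sada.simps
  proof (rule expectation_bind_le[OF finite_sada])
    fix z assume "z \<in> set_pmf (sada d n f R (5 * L) (1 / 4) m xinit S)"
    then have z: "fst z \<in> V" "snd z \<in> V" using sada_in[OF xinit] by auto
    show "measure_pmf.expectation (case z of (x, v) \<Rightarrow> map_pmf (\<lambda>st. (st_x st, st_v st))
        (sada_inner d n f R (5 * L) x ((1 - 1 / 4) *\<^sub>R v + (1 / 4) *\<^sub>R x) m)) gap \<le> 1 / 2 * gap z"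
      using stage_halves_gap[OF z m] by (simp add: case_prod_beta)
  qed (auto simp: finite_sada_inner split: prod.splits)
  also have "\<dots> = 1 / 2 * measure_pmf.expectation (sada d n f R (5 * L) (1 / 4) m xinit S) gap"
    by simp
  also have "\<dots> \<le> 1 / 2 * (1 / 2 ^ S * gap (xinit, xinit))"
    using Suc.IH by (intro mult_left_mono) auto
  also have "\<dots> = 1 / 2 ^ Suc S * gap (xinit, xinit)" by simp
  finally show ?case .
qed

lemma sada_expectations:
  assumes xinit: "xinit \<in> V" and m: "1 \<le> m" "real m = 5 * L / (2 * \<mu>)"
  defines "p \<equiv> sada d n f R (5 * L) (1 / 4) m xinit"
  defines "E1 S \<equiv> measure_pmf.expectation (p S) (\<lambda>(x, v). P x - P xs)"
    and "E2 S \<equiv> measure_pmf.expectation (p S) (\<lambda>(x, v). (norm (v - xs))\<^sup>2)"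
  shows "E1 S + 3 * \<mu> / 2 * E2 S \<le> 1 / 2 ^ S * initial_gap n f R \<mu> xs xinit"
    and "0 \<le> E1 S" "0 \<le> E2 S"
proof -
  have fin: "finite (set_pmf (p S))" unfolding p_def by (rule finite_sada)
  note int = integrable_measure_pmf_finite[OF fin]
  have "gap = (\<lambda>z. (case z of (x, v) \<Rightarrow> P x - P xs)
      + 3 * \<mu> / 2 * (case z of (x, v) \<Rightarrow> (norm (v - xs))\<^sup>2))"
    by (auto simp: gap_def fun_eq_iff)
  then have "measure_pmf.expectation (p S) gap = measure_pmf.expectation (p S)
      (\<lambda>z. (case z of (x, v) \<Rightarrow> P x - P xs) + 3 * \<mu> / 2 * (case z of (x, v) \<Rightarrow> (norm (v - xs))\<^sup>2))"
    by simp
  also have "\<dots> = E1 S + 3 * \<mu> / 2 * E2 S"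
    unfolding E1_def E2_def by (subst Bochner_Integration.integral_add[OF int int]) simp
  finally show "E1 S + 3 * \<mu> / 2 * E2 S \<le> 1 / 2 ^ S * initial_gap n f R \<mu> xs xinit"
    using sada_gap[OF xinit m, of S] unfolding p_def initial_gap_def gap_def by simp
  show "0 \<le> E2 S" unfolding E2_def by (intro Bochner_Integration.integral_nonneg) auto
  have "measure_pmf.expectation (p S) (\<lambda>_. 0) \<le> E1 S"
    unfolding E1_def
  proof (rule expectation_mono_finite[OF fin])
    fix z assume "z \<in> set_pmf (p S)"
    then show "0 \<le> (case z of (x, v) \<Rightarrow> P x - P xs)"
      using sada_in[OF xinit] xs_min unfolding p_def by (auto simp: case_prod_beta)
  qed
  then show "0 \<le> E1 S" by simp
qed

end

lemma sada_setting_problem: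
  assumes "sada_setting d n f L R \<mu> xs xinit m"
  shows "sada_problem d n f R (Lmax n L) \<mu> xs"
proof
  note s = assms[unfolded sada_setting_def]
  fix i assume i: "i \<in> {1..n}"
  have lip: "(L i)-lipschitz_on (rspace d) (nabla d (f i))"
    and conv: "convex_on (rspace d) (f i)" and diff: "f i differentiable_on rspace d"
    using s i by blast+
  have "L i \<le> Lmax n L" using i unfolding Lmax_def by (intro Max_ge) auto
  then have "norm (nabla d (f i) x - nabla d (f i) y) \<le> Lmax n L * norm (x - y)"
    if "x \<in> rspace d" "y \<in> rspace d" for x y
    using lipschitz_onD[OF lip that] mult_right_mono[of "L i" "Lmax n L" "norm (x - y)"]
    by (simp add: dist_norm)
  then show "smooth_convex_on (rspace d) (Lmax n L) (f i) (nabla d (f i))"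
    unfolding smooth_convex_on_def using conv nabla_has_derivative[OF diff] by blast
qed (use assms in \<open>auto simp: sada_setting_def\<close>)


section \<open>Gradient complexity\<close>

text \<open>
  If \<open>D \<le> 2\<^sup>K\<close>, then \<open>K\<close> stages bring the bound down to \<open>1\<close> and about \<open>log\<^sub>2 (1 / \<delta>)\<close> more bring it down to \<open>\<delta>\<close>.
  Since \<open>ln (1 / \<delta>) \<ge> ln 2\<close>, the fixed number of extra stages is absorbed into the constant.
\<close>

lemma halving_stages:
  fixes D :: real
  obtains C where "\<And>\<delta> :: real. 0 < \<delta> \<Longrightarrow> \<delta> \<le> 1 / 2 \<Longrightarrow>
    \<exists>S\<ge>1. 1 / 2 ^ S * D \<le> \<delta> \<and> real S \<le> C * ln (1 / \<delta>)"
proof -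
  obtain K where K: "D \<le> 2 ^ K"
    using real_arch_pow[of 2 D] by (auto intro: less_imp_le)
  have ln2: "0 < ln (2::real)" by simp
  have "\<exists>S\<ge>1. 1 / 2 ^ S * D \<le> \<delta> \<and> real S \<le> (real K + 2) / ln 2 * ln (1 / \<delta>)"
    if \<delta>: "0 < \<delta>" "\<delta> \<le> 1 / 2" for \<delta> :: real
  proof -
    define r where "r = ln (1 / \<delta>) / ln 2"
    have "ln 2 \<le> ln (1 / \<delta>)" using \<delta> by (subst ln_le_cancel_iff) (auto simp: field_simps)
    then have r: "1 \<le> r" unfolding r_def by simp
    define j where "j = nat \<lceil>r\<rceil>"
    have j: "r \<le> real j" "real j \<le> r + 1" using r unfolding j_def by linarith+
    have "1 / \<delta> = 2 powr r" using \<delta> unfolding r_def powr_def by simp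
    also have "\<dots> \<le> 2 powr real j" using j(1) by (intro powr_mono) auto
    finally have "1 / \<delta> \<le> 2 ^ j" by (simp add: powr_realpow)
    then have d: "1 \<le> \<delta> * 2 ^ j" using \<delta> by (simp add: field_simps)
    have "D \<le> 2 ^ K * (\<delta> * 2 ^ j)"
      using K mult_left_mono[OF d, of "2 ^ K"] mult_1_right[of "2 ^ K :: real"]
      by (metis order_trans zero_le_numeral zero_le_power)
    then have "1 / 2 ^ (K + j) * D \<le> \<delta>" by (simp add: field_simps power_add)
    moreover have "1 \<le> K + j" using j(1) r by linarith
    moreover have "real (K + j) \<le> (real K + 2) * r"
      using j(2) r mult_left_mono[OF r, of "real K"] by (simp add: algebra_simps)
    then have "real (K + j) \<le> (real K + 2) / ln 2 * ln (1 / \<delta>)" unfolding r_def by simp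
    ultimately show ?thesis by blast
  qed
  then show thesis by (rule that)
qed

text \<open>
  A stage costs \<open>n + 2 m = n + 5 l / \<mu>\<close> evaluations.
\<close>

lemma sada_evals_le:
  assumes "real m = 5 * l / (2 * \<mu>)" "0 < l" "0 < \<mu>" "real S \<le> C * b"
  shows "real (sada_evals n m S) \<le> 5 * C * (real n + l / \<mu>) * b"
proof -
  have "real (sada_evals n m S) = real S * (real n + 5 * (l / \<mu>))"
    using assms(1) by (simp add: sada_evals_def)
  also have "\<dots> \<le> (C * b) * (5 * (real n + l / \<mu>))"
    using assms by (intro mult_mono) auto
  also have "\<dots> = 5 * C * (real n + l / \<mu>) * b" by (simp only: mult_ac)
  finally show ?thesis .
qed

theorem corollary5p5:
  shows
    "(\<forall>d n f L R \<mu> xs xinit m S.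
        sada_setting d n f L R \<mu> xs xinit m \<longrightarrow>
        measure_pmf.expectation (sada d n f R (5 * Lmax n L) (1 / 4) m xinit S)
            (\<lambda>(x, v). objective n f R x - objective n f R xs)
        + 3 * \<mu> / 2 *
          measure_pmf.expectation (sada d n f R (5 * Lmax n L) (1 / 4) m xinit S)
            (\<lambda>(x, v). (norm (v - xs))\<^sup>2)
        \<le> 1 / 2 ^ S * initial_gap n f R \<mu> xs xinit)
     \<and>
     (\<forall>D. \<exists>C. \<forall>d n f L R \<mu> xs xinit m.
        sada_setting d n f L R \<mu> xs xinit m \<and> initial_gap n f R \<mu> xs xinit = D \<longrightarrow>
        (\<forall>\<epsilon>. 0 < \<epsilon> \<and> \<epsilon> \<le> 1 / 2 \<longrightarrow>
          (\<exists>S\<ge>1.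
             measure_pmf.expectation (sada d n f R (5 * Lmax n L) (1 / 4) m xinit S)
               (\<lambda>(x, v). objective n f R x - objective n f R xs) \<le> \<epsilon> \<and>
             real (sada_evals n m S) \<le> C * (real n + Lmax n L / \<mu>) * ln (1 / \<epsilon>))) \<and>
        (\<forall>\<epsilon>. 0 < \<epsilon> \<and> \<mu> * \<epsilon> \<le> 1 / 2 \<longrightarrow>
          (\<exists>S\<ge>1.
             measure_pmf.expectation (sada d n f R (5 * Lmax n L) (1 / 4) m xinit S)
               (\<lambda>(x, v). (norm (v - xs))\<^sup>2) \<le> \<epsilon> \<and>
             real (sada_evals n m S) \<le> C * (real n + Lmax n L / \<mu>) * ln (1 / (\<mu> * \<epsilon>)))))"
proof (intro conjI allI)
  fix d n f L R \<mu> xs xinit m S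
  show "sada_setting d n f L R \<mu> xs xinit m \<longrightarrow>
        measure_pmf.expectation (sada d n f R (5 * Lmax n L) (1 / 4) m xinit S)
            (\<lambda>(x, v). objective n f R x - objective n f R xs)
        + 3 * \<mu> / 2 *
          measure_pmf.expectation (sada d n f R (5 * Lmax n L) (1 / 4) m xinit S)
            (\<lambda>(x, v). (norm (v - xs))\<^sup>2)
        \<le> 1 / 2 ^ S * initial_gap n f R \<mu> xs xinit"
    using sada_problem.sada_expectations(1)[OF sada_setting_problem]
    by (auto simp: sada_setting_def)
next
  fix D :: real
  obtain C where C: "\<And>\<delta> :: real. 0 < \<delta> \<Longrightarrow> \<delta> \<le> 1 / 2 \<Longrightarrow>
      \<exists>S\<ge>1. 1 / 2 ^ S * D \<le> \<delta> \<and> real S \<le> C * ln (1 / \<delta>)"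
    using halving_stages[of D] by blast
  show "\<exists>C. \<forall>d n f L R \<mu> xs xinit m.
        sada_setting d n f L R \<mu> xs xinit m \<and> initial_gap n f R \<mu> xs xinit = D \<longrightarrow>
        (\<forall>\<epsilon>. 0 < \<epsilon> \<and> \<epsilon> \<le> 1 / 2 \<longrightarrow>
          (\<exists>S\<ge>1.
             measure_pmf.expectation (sada d n f R (5 * Lmax n L) (1 / 4) m xinit S)
               (\<lambda>(x, v). objective n f R x - objective n f R xs) \<le> \<epsilon> \<and>
             real (sada_evals n m S) \<le> C * (real n + Lmax n L / \<mu>) * ln (1 / \<epsilon>))) \<and>
        (\<forall>\<epsilon>. 0 < \<epsilon> \<and> \<mu> * \<epsilon> \<le> 1 / 2 \<longrightarrow>
          (\<exists>S\<ge>1.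
             measure_pmf.expectation (sada d n f R (5 * Lmax n L) (1 / 4) m xinit S)
               (\<lambda>(x, v). (norm (v - xs))\<^sup>2) \<le> \<epsilon> \<and>
             real (sada_evals n m S) \<le> C * (real n + Lmax n L / \<mu>) * ln (1 / (\<mu> * \<epsilon>))))"
  proof (intro exI[of _ "5 * C"] allI impI, elim conjE)
    fix d n f L R \<mu> xs xinit m
    assume set: "sada_setting d n f L R \<mu> xs xinit m" and D: "initial_gap n f R \<mu> xs xinit = D"
    let ?E1 = "\<lambda>S. measure_pmf.expectation (sada d n f R (5 * Lmax n L) (1 / 4) m xinit S)
               (\<lambda>(x, v). objective n f R x - objective n f R xs)"
    let ?E2 = "\<lambda>S. measure_pmf.expectation (sada d n f R (5 * Lmax n L) (1 / 4) m xinit S)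
               (\<lambda>(x, v). (norm (v - xs))\<^sup>2)"
    have xinit: "xinit \<in> rspace d" and m: "1 \<le> m" "real m = 5 * Lmax n L / (2 * \<mu>)"
      and \<mu>: "0 < \<mu>" and L: "0 < Lmax n L"
      using set by (auto simp: sada_setting_def)
    note E = sada_problem.sada_expectations[OF sada_setting_problem[OF set] xinit m, unfolded D]
    have evals: "real (sada_evals n m S) \<le> 5 * C * (real n + Lmax n L / \<mu>) * ln (1 / \<delta>)"
      if "real S \<le> C * ln (1 / \<delta>)" for S \<delta>
      by (rule sada_evals_le[OF m(2) L \<mu> that])
    have "\<exists>S\<ge>1. ?E1 S \<le> \<epsilon> \<and> real (sada_evals n m S) \<le> 5 * C * (real n + Lmax n L / \<mu>) * ln (1 / \<epsilon>)"
      if \<epsilon>: "0 < \<epsilon>" "\<epsilon> \<le> 1 / 2" for \<epsilon>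
    proof -
      obtain S where S: "1 \<le> S" "1 / 2 ^ S * D \<le> \<epsilon>" "real S \<le> C * ln (1 / \<epsilon>)"
        using C[OF \<epsilon>] by blast
      have "0 \<le> 3 * \<mu> / 2 * ?E2 S" using \<mu> E(3)[of S] by simp
      then have "?E1 S \<le> \<epsilon>" using E(1)[of S] S(2) by linarith
      then show ?thesis using S(1) evals[OF S(3)] by blast
    qed
    moreover have "\<exists>S\<ge>1. ?E2 S \<le> \<epsilon> \<and>
        real (sada_evals n m S) \<le> 5 * C * (real n + Lmax n L / \<mu>) * ln (1 / (\<mu> * \<epsilon>))"
      if \<epsilon>: "0 < \<epsilon>" "\<mu> * \<epsilon> \<le> 1 / 2" for \<epsilon>
    proof -
      have pos: "0 < \<mu> * \<epsilon>" using \<mu> \<epsilon> by simp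
      obtain S where S: "1 \<le> S" "1 / 2 ^ S * D \<le> \<mu> * \<epsilon>" "real S \<le> C * ln (1 / (\<mu> * \<epsilon>))"
        using C[OF pos \<epsilon>(2)] by blast
      have "3 / 2 * (\<mu> * ?E2 S) \<le> \<mu> * \<epsilon>" using E(1)[of S] E(2)[of S] S(2) by linarith
      moreover have "0 \<le> \<mu> * ?E2 S" using \<mu> E(3)[of S] by simp
      ultimately have "\<mu> * ?E2 S \<le> \<mu> * \<epsilon>" by linarith
      then have "?E2 S \<le> \<epsilon>" using \<mu> by (simp only: mult_le_cancel_left_pos)
      then show ?thesis using S(1) evals[OF S(3)] by blast
    qed
    ultimately show "(\<forall>\<epsilon>. 0 < \<epsilon> \<and> \<epsilon> \<le> 1 / 2 \<longrightarrow>
          (\<exists>S\<ge>1. ?E1 S \<le> \<epsilon> \<and>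
             real (sada_evals n m S) \<le> 5 * C * (real n + Lmax n L / \<mu>) * ln (1 / \<epsilon>))) \<and>
        (\<forall>\<epsilon>. 0 < \<epsilon> \<and> \<mu> * \<epsilon> \<le> 1 / 2 \<longrightarrow>
          (\<exists>S\<ge>1. ?E2 S \<le> \<epsilon> \<and>
             real (sada_evals n m S) \<le> 5 * C * (real n + Lmax n L / \<mu>) * ln (1 / (\<mu> * \<epsilon>))))"
      by blast
  qed
qed

end
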